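(* Let $m,n\in\mathbb R$, $\mathcal B>0$, $q=m-n+1$, and let $\overline h>0$, $X>0$. Consider the constant steady state $h_{\rm ss}\equiv\overline h$ of $h_t=-(h^nh_{xxx})_x-\mathcal B(h^mh_x)_x$. (a) Suppose $-1<q<3$. Then there exists a zero contact angle droplet steady state $\hat h_{\rm ss}$ of the same equation with length $\hat X\le X$ and area $\overline hX$ if and only if $$\mathcal B\,\overline h^{\,q-1}X^2\ge E(0).$$ If such a droplet steady state exists, then $\mathcal E(\overline h)>\mathcal E(\hat h_{\rm ss})$ if and only if $$\mathcal B\,\overline h^{\,q-1}X^2>L(q),$$ where $L(q)=A(0)^2\left[\frac{3+q}{(3-q)(q+1)}\right]^{(3-q)/q}$ for $-1<q<3$, $q\ne0$, and $L(0)=4e^2\pi/3$. (b) For $q=3$, such a steady state $\hat h_{\rm ss}$ (zero contact angle, length at most $X$, area $\overline hX$) exists if and only if $\mathcal B\,\overline h^{\,2}X^2=E(0)$. For $q>3$, such a $\hat h_{\rm ss}$ exists if and only if $\mathcal B\,\overline h^{\,q-1}X^2\le E(0)$. For all $q\ge3$, if $\hat h_{\rm ss}$ exists then $\mathcal E(\overline h)<\mathcal E(\hat h_{\rm ss})$.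
   Context: For $q>-1$, $k_0$ denotes the $C^1$ periodic function on $\mathbb R$, of least period $P(0)>0$, with $k_0(0)=k_0'(0)=0$, that is positive on $(0,P(0))$ and satisfies there $k''+\frac{k^q-1}{q}=0$ (if $q\ne0$) or $k''+\log k=0$ (if $q=0$); it exists and is unique. Put $A(0)=\int_0^{P(0)}k_0\,dx$ and $E(0)=P(0)^{3-q}A(0)^{q-1}$. A droplet steady state is a function that is positive on some interval $(a,b)$ and zero elsewhere, is $C^1$ on $[a,b]$, satisfies the steady state equation $(h^nh'''+\mathcal B h^mh')'=0$ classically on the open interval $(a,b)$, and has equal acute contact angles: $0\le h'(a)=-h'(b)<\infty$ (one-sided derivatives). It has zero contact angle if $h'(a)=h'(b)=0$. Its length is $b-a$ and its area is $\int_a^bh\,dx$. A droplet of length at most $X$ is regarded as a function on one period of the circle of circumference $X$ (zero off $(a,b)$). Energy at period $X$: for nonnegative $\ell\in H^1$ of the circle of circumference $X$, $\mathcal E(\ell)=\int_0^X[\frac12(\ell')^2-H(\ell)]dx$, where $H$ is a fixed function with $H''(y)=\mathcal B y^{q-1}$ for $y>0$, extended continuously to $y=0$ (possible since $q>-1$). The same $H$ is used for both functions. *)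

theory Defs
  imports "HOL-Analysis.Analysis"
begin

definition profile_equation :: "real \<Rightarrow> (real \<Rightarrow> real) \<Rightarrow> (real \<Rightarrow> real) \<Rightarrow> real \<Rightarrow> bool" where
  "profile_equation q k k' x \<longleftrightarrow>
     (\<exists>k''. (k' has_real_derivative k'') (at x) \<and>
        (if q = 0 then k'' + ln (k x) = 0 else k'' + (k x powr q - 1) / q = 0))"

definition least_period :: "(real \<Rightarrow> real) \<Rightarrow> real \<Rightarrow> bool" where
  "least_period k P \<longleftrightarrow>
     P > 0 \<and> (\<forall>x. k (x + P) = k x) \<and> (\<forall>T. 0 < T \<and> T < P \<longrightarrow> \<not> (\<forall>x. k (x + T) = k x))"

definition is_zero_angle_profile :: "real \<Rightarrow> (real \<Rightarrow> real) \<Rightarrow> real \<Rightarrow> bool" where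
  "is_zero_angle_profile q k P \<longleftrightarrow>
     least_period k P \<and>
     (\<exists>k'. (\<forall>x. (k has_real_derivative k' x) (at x)) \<and> continuous_on UNIV k' \<and>
           k 0 = 0 \<and> k' 0 = 0 \<and>
           (\<forall>x\<in>{0<..<P}. k x > 0 \<and> profile_equation q k k' x))"

text \<open>For \<open>q > -1\<close> exactly one pair \<open>(k, P)\<close> satisfies the predicate above, so the descriptions
  below denote the intended profile and its period; for other \<open>q\<close> nothing is claimed.\<close>

definition k0 :: "real \<Rightarrow> real \<Rightarrow> real" where
  "k0 q = (THE k. \<exists>P. is_zero_angle_profile q k P)"

definition P0 :: "real \<Rightarrow> real" where
  "P0 q = (THE P. is_zero_angle_profile q (k0 q) P)"

definition A0 :: "real \<Rightarrow> real" where
  "A0 q = integral {0..P0 q} (k0 q)"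

definition E0 :: "real \<Rightarrow> real" where
  "E0 q = P0 q powr (3 - q) * A0 q powr (q - 1)"

definition L :: "real \<Rightarrow> real" where
  "L q = (if q = 0 then 4 * (exp 1)\<^sup>2 * pi / 3
          else (A0 q)\<^sup>2 * ((3 + q) / ((3 - q) * (q + 1))) powr ((3 - q) / q))"

text \<open>The equation \<open>(h\<^sup>n h''' + B h\<^sup>m h')' = 0\<close> on an open interval where \<open>h > 0\<close>. No continuity of
  \<open>h'''\<close> is required separately: solving for \<open>h'''\<close> shows that it is differentiable.\<close>

definition steady_state_on :: "real \<Rightarrow> real \<Rightarrow> real \<Rightarrow> real \<Rightarrow> real \<Rightarrow> (real \<Rightarrow> real) \<Rightarrow> bool" where
  "steady_state_on m n B a b h \<longleftrightarrow>
     (\<exists>h1 h2 h3. \<forall>x\<in>{a<..<b}.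
        (h has_real_derivative h1 x) (at x) \<and>
        (h1 has_real_derivative h2 x) (at x) \<and>
        (h2 has_real_derivative h3 x) (at x) \<and>
        ((\<lambda>y. h y powr n * h3 y + B * h y powr m * h1 y) has_real_derivative 0) (at x))"

definition droplet_steady_state ::
    "real \<Rightarrow> real \<Rightarrow> real \<Rightarrow> real \<Rightarrow> real \<Rightarrow> (real \<Rightarrow> real) \<Rightarrow> bool" where
  "droplet_steady_state m n B a b h \<longleftrightarrow>
     a < b \<and>
     (\<forall>x\<in>{a<..<b}. h x > 0) \<and> (\<forall>x. x \<notin> {a<..<b} \<longrightarrow> h x = 0) \<and>
     (\<exists>h'. (\<forall>x\<in>{a..b}. (h has_real_derivative h' x) (at x within {a..b})) \<and>
           continuous_on {a..b} h' \<and> 0 \<le> h' a \<and> h' a = - h' b) \<and>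
     steady_state_on m n B a b h"

definition zero_contact_angle :: "real \<Rightarrow> real \<Rightarrow> (real \<Rightarrow> real) \<Rightarrow> bool" where
  "zero_contact_angle a b h \<longleftrightarrow>
     (h has_real_derivative 0) (at a within {a..b}) \<and>
     (h has_real_derivative 0) (at b within {a..b})"

definition zero_angle_droplet ::
    "real \<Rightarrow> real \<Rightarrow> real \<Rightarrow> real \<Rightarrow> real \<Rightarrow> real \<Rightarrow> real \<Rightarrow> (real \<Rightarrow> real) \<Rightarrow> bool" where
  "zero_angle_droplet m n B X area a b h \<longleftrightarrow>
     droplet_steady_state m n B a b h \<and> zero_contact_angle a b h \<and>
     b - a \<le> X \<and> integral {a..b} h = area"

text \<open>The \<open>X\<close>-periodic function that agrees with \<open>h\<close> on \<open>[a, a + X)\<close>; this is how a droplet on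
  \<open>(a, b)\<close> with \<open>b - a \<le> X\<close> becomes a function on the circle of circumference \<open>X\<close>.\<close>

definition periodize :: "real \<Rightarrow> real \<Rightarrow> (real \<Rightarrow> real) \<Rightarrow> real \<Rightarrow> real" where
  "periodize X a h x = h (a + X * frac ((x - a) / X))"

definition energy_density :: "real \<Rightarrow> real \<Rightarrow> (real \<Rightarrow> real) \<Rightarrow> bool" where
  "energy_density B q H \<longleftrightarrow>
     continuous_on {0..} H \<and>
     (\<exists>H'. \<forall>y>0. (H has_real_derivative H' y) (at y) \<and>
                  (H' has_real_derivative B * y powr (q - 1)) (at y))"

text \<open>Functions in \<open>H\<^sup>1\<close> of the circle are represented by \<open>X\<close>-periodic functions on the line. They are
  absolutely continuous, so \<^const>\<open>deriv\<close> exists almost everywhere and is the weak derivative.\<close>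

definition energy :: "(real \<Rightarrow> real) \<Rightarrow> real \<Rightarrow> (real \<Rightarrow> real) \<Rightarrow> real" where
  "energy H X l = integral {0..X} (\<lambda>x. (deriv l x)\<^sup>2 / 2 - H (l x))"

end

theory Submission
  imports Defs "HOL-Probability.Distributions" "HOL-Real_Asymp.Real_Asymp"
begin

text \<open>A droplet with zero contact angle has vanishing flux constant, hence \<open>h'' + B qlog q h\<close> is constant
  on it and the droplet is a rescaling \<open>h(x) = l k\<^sub>0((x - a) / w)\<close> of the profile with
  \<open>w\<^sup>2 B l\<^sup>q = l\<close>. Here \<open>qlog q y = (y\<^sup>q - 1) / q\<close> (\<open>ln y\<close> if \<open>q = 0\<close>) treats all
  exponents alike. The area condition \<open>l w A(0) = hbar X\<close> is linear in \<open>ln l\<close> and determines \<open>l\<close> unless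
  \<open>q = 3\<close>; the length condition \<open>w P(0) \<le> X\<close> is then the comparison with \<open>E(0)\<close>. By the identity
  \<open>\<integral> k\<^sub>0'\<^sup>2 = 2 A(0) / (q + 3)\<close> the energy of the droplet is an explicit function of \<open>l\<close>, and comparing it
  with the energy of the constant gives \<open>L(q)\<close>. For \<open>q = 0\<close> the area \<open>A(0)\<close> is a Gaussian integral.\<close>

section \<open>The q-logarithm and the first integral\<close>

text \<open>The difficulty sits at the contact points. For q < 1 \<open>qlog q\<close> is not
  Lipschitz at height 0 (for q \<le> 0 it is even unbounded), so standard initial value theory
  yields neither existence nor uniqueness of the profile. Existence comes instead from a phase
  variable in which the time integral has a continuous density; uniqueness comes from quadrature,
  since the time needed to reach a given height depends on q alone. Likewise nothing bounds h'' or
  h''' of a droplet near its ends, so its flux constant cannot be read off there; a monotone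
  quantity, cut off at a small level h = e, replaces the limit. The constant value of h'' + B
  qlog(h) is absorbed by the scale l, because dilations act affinely on \<open>qlog\<close>. Both
  thresholds arise by eliminating l. Multiplying the length condition by 3 - q allows the area
  relation to remove l, which leaves E(0); the sign of 3 - q reverses the inequality across q = 3.
  The area relation also reads B hbar^(q-1) X^2 = A(0)^2 (l/hbar)^(3-q), so this quantity and the
  energy gap are both governed by the ratio l/hbar, and L(q) is the value at which the gap
  vanishes.\<close>

definition qlog :: "real \<Rightarrow> real \<Rightarrow> real" where
  "qlog q y = (if q = 0 then ln y else (y powr q - 1) / q)"

text \<open>The antiderivative of \<open>- 2 * qlog q\<close> that vanishes at 0. Along the profile
  it is \<open>(k')^2\<close> as a function of the height.\<close>

definition speed_sq :: "real \<Rightarrow> real \<Rightarrow> real" where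
  "speed_sq q y = 2 * y * (1 - qlog q y) / (q + 1)"

text \<open>The positive zero of \<open>speed_sq q\<close>, hence the maximal height of the profile.
  The value at q = 0 is the limit of \<open>(1 + q) powr (1 / q)\<close>.\<close>

definition peak :: "real \<Rightarrow> real" where
  "peak q = (if q = 0 then exp 1 else (1 + q) powr (1 / q))"

lemma profile_equation_iff:
  "profile_equation q k k' x \<longleftrightarrow> (k' has_real_derivative - qlog q (k x)) (at x)"
proof -
  have "(if q = 0 then k'' + ln (k x) = 0 else k'' + (k x powr q - 1) / q = 0)
      \<longleftrightarrow> k'' = - qlog q (k x)" for k''
    by (auto simp: qlog_def)
  then show ?thesis
    by (simp add: profile_equation_def)
qed

lemma powr_eq_qlog: "y > 0 \<Longrightarrow> y powr q = 1 + q * qlog q y"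
  by (simp add: qlog_def)

text \<open>This affine behaviour under dilations drives the rescaling: the additive term
  \<open>qlog q l\<close> later cancels the constant of integration of a droplet.\<close>

lemma qlog_mult:
  assumes "l > 0" "y > 0"
  shows "qlog q (l * y) = l powr q * qlog q y + qlog q l"
  using assms by (auto simp: qlog_def ln_mult powr_mult field_simps)

lemma DERIV_qlog [derivative_intros]:
  assumes "(f has_real_derivative D) (at x within S)" "f x > 0"
  shows "((\<lambda>x. qlog q (f x)) has_real_derivative f x powr (q - 1) * D) (at x within S)"
proof (cases "q = 0")
  case True
  then show ?thesis
    using assms unfolding qlog_def
    by (auto intro!: derivative_eq_intros simp: powr_minus field_simps)
next
  case False
  have "((\<lambda>y. (y powr q - 1) / q) has_real_derivative (f x powr (q - 1))) (at (f x))"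
    using False assms(2) by (auto intro!: derivative_eq_intros)
  from DERIV_chain2[OF this assms(1)] show ?thesis
    using False by (simp add: qlog_def)
qed

lemma qlog_strict_mono:
  assumes "0 < x" "x < y"
  shows "qlog q x < qlog q y"
proof (rule DERIV_pos_imp_increasing[OF assms(2)])
  fix z assume "x \<le> z" "z \<le> y"
  then have "(qlog q has_real_derivative z powr (q - 1)) (at z)" "z powr (q - 1) > 0"
    using assms(1) DERIV_qlog[of "\<lambda>x. x" 1 z UNIV q] by auto
  then show "\<exists>d. (qlog q has_real_derivative d) (at z) \<and> 0 < d" by blast
qed

lemma continuous_on_qlog: "continuous_on {0<..} (qlog q)"
proof (rule DERIV_continuous_on)
  fix x :: real assume "x \<in> {0<..}"
  then show "(qlog q has_real_derivative x powr (q - 1)) (at x within {0<..})"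
    using DERIV_qlog[of "\<lambda>x. x" 1 x "{0<..}" q] by auto
qed

context
  fixes q :: real
  assumes q: "-1 < q"
begin

lemma peak_pos: "peak q > 0"
  using q by (simp add: peak_def)

lemma qlog_peak: "qlog q (peak q) = 1"
  using q by (simp add: qlog_def peak_def powr_powr)

lemma qlog_less_1: "0 < y \<Longrightarrow> y < peak q \<Longrightarrow> qlog q y < 1"
  using qlog_strict_mono[of y "peak q" q] qlog_peak by simp

lemma speed_sq_0: "speed_sq q 0 = 0"
  by (simp add: speed_sq_def)

lemma speed_sq_peak: "speed_sq q (peak q) = 0"
  by (simp add: speed_sq_def qlog_peak)

lemma speed_sq_pos: "0 < y \<Longrightarrow> y < peak q \<Longrightarrow> speed_sq q y > 0"
  using q qlog_less_1[of y] by (simp add: speed_sq_def)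

lemma speed_sq_neg: "y > peak q \<Longrightarrow> speed_sq q y < 0"
  using q qlog_strict_mono[of "peak q" y q] peak_pos
  by (simp add: speed_sq_def qlog_peak field_simps)

lemma speed_sq_eq_0_iff: "y > 0 \<Longrightarrow> speed_sq q y = 0 \<longleftrightarrow> y = peak q"
  using speed_sq_pos[of y] speed_sq_neg[of y] speed_sq_peak by (metis linorder_neqE_linordered_idom order_less_irrefl)

text \<open>The relation \<open>y powr q = 1 + q * qlog q y\<close> eliminates the power from the
  product rule; what remains is a multiple of \<open>(q + 1) * qlog q y\<close>, and the factor q +
  1 cancels.\<close>

lemma DERIV_speed_sq [derivative_intros]:
  assumes "(f has_real_derivative D) (at x within S)" "f x > 0"
  shows "((\<lambda>x. speed_sq q (f x)) has_real_derivative - 2 * qlog q (f x) * D) (at x within S)"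
proof -
  let ?y = "f x"
  have p: "?y * ?y powr (q - 1) = 1 + q * qlog q ?y"
    using assms(2) powr_eq_qlog[of ?y q] by (simp add: powr_diff)
  have "((\<lambda>x. speed_sq q (f x)) has_real_derivative
      2 / (q + 1) * (D * (1 - qlog q ?y) - ?y * (?y powr (q - 1) * D))) (at x within S)"
  proof -
    have "((\<lambda>x. 2 / (q + 1) * (f x * (1 - qlog q (f x)))) has_real_derivative
        2 / (q + 1) * (D * (1 - qlog q ?y) - ?y * (?y powr (q - 1) * D))) (at x within S)"
    proof (rule DERIV_cmult)
      show "((\<lambda>x. f x * (1 - qlog q (f x))) has_real_derivative
        D * (1 - qlog q ?y) - ?y * (?y powr (q - 1) * D)) (at x within S)"
        using assms by (auto intro!: derivative_eq_intros simp: algebra_simps)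
    qed
    then show ?thesis by (simp add: speed_sq_def[abs_def] mult.assoc)
  qed
  also have "D * (1 - qlog q ?y) - ?y * (?y powr (q - 1) * D) = D * (1 - qlog q ?y - ?y * ?y powr (q - 1))"
    by (simp add: algebra_simps)
  also have "2 / (q + 1) * (D * (1 - qlog q ?y - ?y * ?y powr (q - 1))) = - 2 * qlog q ?y * D"
    unfolding p using q by (simp add: field_simps)
  finally show ?thesis .
qed

text \<open>Only height 0 is delicate, since \<open>qlog q\<close> may blow up there. The factor y
  compensates: the critical term is \<open>y powr (q + 1)\<close>, which tends to 0 because q >
  -1.\<close>

lemma continuous_on_speed_sq: "continuous_on {0..} (speed_sq q)"
proof -
  have "continuous (at y within {0..}) (speed_sq q)" if "y \<ge> 0" for y
  proof (cases "y = 0")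
    case False
    then have "((\<lambda>x. speed_sq q x) has_real_derivative - 2 * qlog q y * 1) (at y within {0..})"
      using that by (intro DERIV_speed_sq) (auto intro!: derivative_eq_intros)
    then show ?thesis
      using DERIV_continuous by blast
  next
    case True
    have *: "((\<lambda>y::real. speed_sq q y) \<longlongrightarrow> 0) (at_right 0)"
    proof (cases "q = 0")
      case True
      then show ?thesis
        unfolding speed_sq_def qlog_def by simp real_asymp
    next
      case False
      have "((\<lambda>y::real. y powr (q + 1)) \<longlongrightarrow> 0) (at_right 0)"
        if "q + 1 > 0" using that by real_asymp
      then have "((\<lambda>y::real. 2 / (q + 1) * ((1 + 1 / q) * y - y powr (q + 1) / q)) \<longlongrightarrow>
          2 / (q + 1) * ((1 + 1 / q) * 0 - 0 / q)) (at_right 0)"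
        using q False by (intro tendsto_intros) auto
      then have "((\<lambda>y::real. 2 / (q + 1) * ((1 + 1 / q) * y - y powr (q + 1) / q)) \<longlongrightarrow> 0) (at_right 0)"
        by simp
      moreover have "eventually (\<lambda>y. 2 / (q + 1) * ((1 + 1 / q) * y - y powr (q + 1) / q) = speed_sq q y) (at_right 0)"
        using eventually_at_right_less[of 0]
      proof eventually_elim
        case (elim y)
        then have "(1 + 1 / q) * y - y powr (q + 1) / q = y * (1 - qlog q y)"
          using False by (simp add: qlog_def powr_add field_simps)
        then show ?case
          by (simp add: speed_sq_def)
      qed
      ultimately show ?thesis
        by (rule Lim_transform_eventually)
    qed
    have "at (0::real) within {0..} = at_right 0"
      by (metis at_within_Ici_at_right)
    then show ?thesis
      using * True by (simp add: continuous_within speed_sq_0)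
  qed
  then show ?thesis
    by (simp add: continuous_on_eq_continuous_within)
qed

end

section \<open>Existence of the profile\<close>

text \<open>L'Hopital's rule for the difference quotient. It supplies the derivatives of the profile
  at the isolated points where the explicit formulas degenerate: its zeros for the first derivative,
  its crest for the second.\<close>

lemma has_real_derivative_of_limit:
  fixes f f' :: "real \<Rightarrow> real"
  assumes "isCont f x" "isCont f' x"
    and "eventually (\<lambda>y. (f has_real_derivative f' y) (at y)) (at x)"
  shows "(f has_real_derivative f' x) (at x)"
proof -
  have "((\<lambda>y. (f y - f x) / (y - x)) \<longlongrightarrow> f' x) (at x)"
  proof (rule lhopital)
    show "((\<lambda>y. f y - f x) \<longlongrightarrow> 0) (at x)"
      using assms(1) by (simp add: isCont_def LIM_zero)
    show "((\<lambda>y. y - x) \<longlongrightarrow> 0) (at x)"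
      by (intro LIM_zero) simp
    show "\<forall>\<^sub>F y in at x. y - x \<noteq> 0"
      by (simp add: eventually_at_filter)
    show "\<forall>\<^sub>F y in at x. ((\<lambda>y. f y - f x) has_real_derivative f' y) (at y)"
      using assms(3) by eventually_elim (auto intro!: derivative_eq_intros)
    show "\<forall>\<^sub>F y in at x. ((\<lambda>y. y - x) has_real_derivative 1) (at y)"
      by (auto intro!: always_eventually derivative_eq_intros)
    show "((\<lambda>y. f' y / 1) \<longlongrightarrow> f' x) (at x)"
      using assms(2) by (simp add: isCont_def)
  qed simp
  then show ?thesis
    by (simp add: has_field_derivative_iff)
qed

text \<open>The difference quotient of \<open>qlog q\<close> based at the peak, where
  \<open>qlog q\<close> is 1, completed by the derivative. It divides the simple zero at the peak
  out of \<open>1 - qlog q s\<close>.\<close>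

definition qlog_slope :: "real \<Rightarrow> real \<Rightarrow> real" where
  "qlog_slope q s =
     (if s = peak q then peak q powr (q - 1) else (qlog q s - 1) / (s - peak q))"

text \<open>The factor left in \<open>ds / sqrt (speed_sq q s)\<close> after the substitution
  \<open>s = peak q * (sin \<theta>)\<^sup>2\<close> (up to \<open>2 d\<theta>\<close>). Both endpoint singularities cancel.\<close>

definition time_density :: "real \<Rightarrow> real \<Rightarrow> real" where
  "time_density q s = (if s = 0 \<and> q \<le> 0 then 0 else sqrt ((q + 1) / (2 * qlog_slope q s)))"

context
  fixes q :: real
  assumes q: "-1 < q"
begin

lemma qlog_slope_pos:
  assumes "0 < s \<or> s = 0 \<and> q > 0" "s \<le> peak q"
  shows "qlog_slope q s > 0"
proof (cases "s = peak q")
  case True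
  then show ?thesis
    using peak_pos[OF q] by (simp add: qlog_slope_def)
next
  case False
  have "qlog q s < 1"
  proof (cases "s = 0")
    case True
    have "- 1 / q < 1" if "q > 0" using that by (simp add: field_simps)
    with True show ?thesis using assms by (simp add: qlog_def)
  next
    case s: False
    then show ?thesis using qlog_less_1[OF q, of s] assms False by auto
  qed
  then show ?thesis
    using False assms by (simp add: qlog_slope_def divide_neg_neg)
qed

lemma isCont_qlog_slope:
  assumes "0 < s"
  shows "isCont (qlog_slope q) s"
proof (cases "s = peak q")
  case True
  have "((\<lambda>s. (qlog q s - qlog q (peak q)) / (s - peak q)) \<longlongrightarrow> peak q powr (q - 1)) (at (peak q))"
    using DERIV_qlog[OF DERIV_ident, of "peak q" q UNIV] peak_pos[OF q]
    unfolding has_field_derivative_iff by simp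
  then have "(qlog_slope q \<longlongrightarrow> peak q powr (q - 1)) (at (peak q))"
    by (rule Lim_transform_eventually)
      (simp add: eventually_at_filter qlog_slope_def qlog_peak[OF q])
  then show ?thesis
    using True by (simp add: isCont_def qlog_slope_def)
next
  case False
  have "isCont (\<lambda>s. (qlog q s - 1) / (s - peak q)) s"
  proof -
    have "isCont (qlog q) s"
      using continuous_on_qlog[of q] assms continuous_on_eq_continuous_at[of "{0::real<..}" "qlog q"] by auto
    then show ?thesis
      using False by (intro continuous_intros) auto
  qed
  moreover have "\<forall>\<^sub>F s in nhds s. (qlog q s - 1) / (s - peak q) = qlog_slope q s"
    using t1_space_nhds[OF False] by eventually_elim (simp add: qlog_slope_def)
  ultimately show ?thesis
    using isCont_cong by fast
qed

lemma time_density_nonneg: "0 \<le> s \<Longrightarrow> s \<le> peak q \<Longrightarrow> time_density q s \<ge> 0"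
  using qlog_slope_pos[of s] q by (cases "s = 0") (auto simp: time_density_def)

lemma time_density_pos: "0 < s \<Longrightarrow> s \<le> peak q \<Longrightarrow> time_density q s > 0"
  using qlog_slope_pos[of s] q by (auto simp: time_density_def)

text \<open>\<open>speed_sq q s\<close> factors as \<open>s * (peak q - s)\<close> times
  \<open>2 * qlog_slope q s / (q + 1)\<close>, and the last factor is the reciprocal of the squared
  density.\<close>

lemma time_density_speed:
  assumes "0 < s" "s < peak q"
  shows "(time_density q s)\<^sup>2 * speed_sq q s = s * (peak q - s)"
proof -
  have 1: "(time_density q s)\<^sup>2 = (q + 1) / (2 * qlog_slope q s)"
    using qlog_slope_pos[of s] q assms by (auto simp: time_density_def)
  have 2: "qlog_slope q s = (1 - qlog q s) / (peak q - s)"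
    using assms by (simp add: qlog_slope_def field_simps)
  have "(a / (2 * (b / c))) * (2 * s * b / a) = s * c"
    if "a > 0" "b > 0" "c > 0" for a b c :: real
    using that by (simp add: field_simps)
  from this[of "q + 1" "1 - qlog q s" "peak q - s"] show ?thesis
    unfolding speed_sq_def 1 2 using qlog_less_1[OF q assms] assms q by linarith
qed

text \<open>At the peak, \<open>qlog_slope\<close> was completed continuously. At 0 there are two
  regimes: for q > 0 the convention \<open>0 powr q = 0\<close> makes the value at 0 agree with the
  limit, while for q \<le> 0 the slope diverges, which is why the density is set to 0 there.\<close>

lemma continuous_on_time_density: "continuous_on {0..peak q} (time_density q)"
proof -
  have "continuous (at s within {0..peak q}) (time_density q)" if s: "s \<in> {0..peak q}" for s
  proof (cases "s = 0")
    case False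
    then have s0: "s > 0" using s by auto
    have "isCont (\<lambda>s. sqrt ((q + 1) / (2 * qlog_slope q s))) s"
      using isCont_qlog_slope[OF s0] qlog_slope_pos[of s] s s0 by (intro continuous_intros) auto
    moreover have "\<forall>\<^sub>F s in nhds s. sqrt ((q + 1) / (2 * qlog_slope q s)) = time_density q s"
      using t1_space_nhds[OF False] by eventually_elim (simp add: time_density_def)
    ultimately have "isCont (time_density q) s"
      using isCont_cong by fast
    then show ?thesis
      using continuous_at_imp_continuous_at_within by blast
  next
    case True
    have h: "peak q > 0" using peak_pos[OF q] .
    have "(time_density q \<longlongrightarrow> time_density q 0) (at_right 0)"
    proof (cases "q > 0")
      case True
      have "((\<lambda>s::real. s powr q) \<longlongrightarrow> 0) (at_right 0)" using True by real_asymp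
      then have "((\<lambda>s. (qlog q s - 1) / (s - peak q)) \<longlongrightarrow> ((0 - 1) / q - 1) / (0 - peak q)) (at_right 0)"
      proof -
        have "qlog q = (\<lambda>s. (s powr q - 1) / q)"
          using True by (auto simp: qlog_def)
        then show ?thesis
          using True h \<open>((\<lambda>s::real. s powr q) \<longlongrightarrow> 0) (at_right 0)\<close>
          by (simp only:, intro tendsto_intros) auto
      qed
      moreover have "\<forall>\<^sub>F s in at_right 0. (qlog q s - 1) / (s - peak q) = qlog_slope q s"
        using eventually_at_right_real[OF h] by eventually_elim (simp add: qlog_slope_def)
      ultimately have "(qlog_slope q \<longlongrightarrow> ((0 - 1) / q - 1) / (0 - peak q)) (at_right 0)"
        by (rule Lim_transform_eventually)
      moreover have "((0 - 1) / q - 1) / (0 - peak q) = qlog_slope q 0"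
        using h True by (simp add: qlog_slope_def qlog_def)
      ultimately have "((\<lambda>s. sqrt ((q + 1) / (2 * qlog_slope q s))) \<longlongrightarrow> sqrt ((q + 1) / (2 * qlog_slope q 0))) (at_right 0)"
        using qlog_slope_pos[of 0] True h by (intro tendsto_intros) auto
      then show ?thesis
        using True by (simp add: time_density_def[abs_def])
    next
      case False
      have lim: "filterlim (\<lambda>s. 1 - qlog q s) at_top (at_right 0)"
      proof (cases "q = 0")
        case True
        then show ?thesis unfolding qlog_def by simp real_asymp
      next
        case q0: False
        then have "q < 0" using False by simp
        then show ?thesis unfolding qlog_def using q0 by simp real_asymp
      qed
      have "filterlim (\<lambda>s. qlog_slope q s) at_top (at_right 0)"
      proof (rule filterlim_at_top_mono)
        show "filterlim (\<lambda>s. inverse (peak q) * (1 - qlog q s)) at_top (at_right 0)"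
          using h by (intro filterlim_tendsto_pos_mult_at_top[OF tendsto_const _ lim]) auto
        show "\<forall>\<^sub>F s in at_right 0. inverse (peak q) * (1 - qlog q s) \<le> qlog_slope q s"
          using eventually_at_right_real[OF h]
        proof eventually_elim
          case (elim s)
          then have "qlog_slope q s = (1 - qlog q s) / (peak q - s)"
            by (simp add: qlog_slope_def field_simps)
          moreover have "(1 - qlog q s) / peak q \<le> (1 - qlog q s) / (peak q - s)"
            using elim qlog_less_1[OF q, of s] h by (intro divide_left_mono) auto
          ultimately show ?case by (simp add: field_simps)
        qed
      qed
      then have "filterlim (\<lambda>s. 2 * qlog_slope q s) at_infinity (at_right 0)"
        using filterlim_at_top_imp_at_infinity filterlim_tendsto_pos_mult_at_top[OF tendsto_const[of 2]]
        by fastforce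
      then have "((\<lambda>s. sqrt ((q + 1) / (2 * qlog_slope q s))) \<longlongrightarrow> sqrt 0) (at_right 0)"
        by (intro tendsto_real_sqrt tendsto_divide_0[OF tendsto_const])
      moreover have "\<forall>\<^sub>F s in at_right 0. sqrt ((q + 1) / (2 * qlog_slope q s)) = time_density q s"
        using eventually_at_right_less[of 0] by eventually_elim (simp add: time_density_def)
      ultimately have "(time_density q \<longlongrightarrow> sqrt 0) (at_right 0)"
        by (rule Lim_transform_eventually)
      then show ?thesis
        using False by (simp add: time_density_def)
    qed
    then have "continuous (at 0 within {0<..}) (time_density q)"
      by (simp add: continuous_within)
    then have "continuous (at 0 within {0..peak q}) (time_density q)"
      using True h at_within_Icc_at_right by metis
    then show ?thesis using True by simp
  qed
  then show ?thesis
    by (simp add: continuous_on_eq_continuous_within)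
qed

end

text \<open>\<open>arc_time q \<theta>\<close> is the time the profile needs to reach the phase \<open>\<theta>\<close>, where the phase is
  defined by \<open>k = peak q * (sin \<theta>)\<^sup>2\<close>; one period of \<open>k\<close> is a phase increment of \<open>\<pi>\<close>.\<close>

definition arc_time :: "real \<Rightarrow> real \<Rightarrow> real" where
  "arc_time q = (SOME t. t 0 = 0 \<and>
     (\<forall>\<theta>. (t has_real_derivative 2 * time_density q (peak q * (sin \<theta>)\<^sup>2)) (at \<theta>)))"

definition phase :: "real \<Rightarrow> real \<Rightarrow> real" where
  "phase q = inv (arc_time q)"

definition profile :: "real \<Rightarrow> real \<Rightarrow> real" where
  "profile q x = peak q * (sin (phase q x))\<^sup>2"

text \<open>The chain rule with \<open>1 / (2 * time_density)\<close> as the derivative of the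
  phase. At a zero of the profile the numerator vanishes, so the value is 0 there even if the
  denominator is 0 as well.\<close>

definition profile_deriv :: "real \<Rightarrow> real \<Rightarrow> real" where
  "profile_deriv q x = peak q * sin (phase q x) * cos (phase q x) / time_density q (profile q x)"

section \<open>The profile in the phase variable: regularity, first integral, equation\<close>

context
  fixes q :: real
  assumes q: "-1 < q"
begin

lemma peak_sin_in: "peak q * (sin \<theta>)\<^sup>2 \<in> {0..peak q}"
proof -
  have "(sin \<theta>)\<^sup>2 \<le> 1" by (simp add: abs_square_le_1)
  then show ?thesis
    using peak_pos[OF q] by (simp add: mult_left_le)
qed

lemma continuous_on_arc_density: "continuous_on UNIV (\<lambda>\<theta>. 2 * time_density q (peak q * (sin \<theta>)\<^sup>2))"
  using peak_sin_in
  by (intro continuous_intros continuous_on_compose2[OF continuous_on_time_density[OF q]]) auto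

lemma arc_time_props:
  "arc_time q 0 = 0"
  "(arc_time q has_real_derivative 2 * time_density q (peak q * (sin \<theta>)\<^sup>2)) (at \<theta>)"
proof -
  let ?w = "\<lambda>\<theta>. 2 * time_density q (peak q * (sin \<theta>)\<^sup>2)"
  have "isCont ?w \<theta>" for \<theta>
    using continuous_on_arc_density continuous_on_eq_continuous_at by blast
  then have "\<exists>F. \<forall>x::real. -\<infinity> < ereal x \<longrightarrow> ereal x < \<infinity> \<longrightarrow> (F has_vector_derivative ?w x) (at x)"
    by (intro einterval_antiderivative) auto
  then obtain F where F: "\<And>x. (F has_real_derivative ?w x) (at x)"
    by (auto simp: has_real_derivative_iff_has_vector_derivative)
  have "\<exists>t. t 0 = 0 \<and> (\<forall>\<theta>. (t has_real_derivative ?w \<theta>) (at \<theta>))"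
    by (rule exI[of _ "\<lambda>x. F x - F 0"]) (auto intro!: derivative_eq_intros F)
  from someI_ex[OF this] show "arc_time q 0 = 0" "(arc_time q has_real_derivative ?w \<theta>) (at \<theta>)"
    unfolding arc_time_def by blast+
qed

lemma isCont_arc_time: "isCont (arc_time q) \<theta>"
  using arc_time_props(2) DERIV_isCont by blast

lemma arc_density_pos: "sin \<theta> \<noteq> 0 \<Longrightarrow> time_density q (peak q * (sin \<theta>)\<^sup>2) > 0"
  using time_density_pos[OF q] peak_sin_in[of \<theta>] peak_pos[OF q] by simp

lemma arc_time_strict_mono: "strict_mono (arc_time q)"
proof (rule strict_monoI)
  fix a b :: real assume ab: "a < b"
  have mono: "arc_time q x \<le> arc_time q y" if "x \<le> y" for x y
    using that time_density_nonneg[OF q] peak_sin_in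
    by (intro DERIV_nonneg_imp_nondecreasing[OF that]) (auto intro!: exI arc_time_props(2))
  show "arc_time q a < arc_time q b"
  proof (rule ccontr)
    assume "\<not> ?thesis"
    then have const: "arc_time q x = arc_time q a" if "x \<in> {a<..<b}" for x
      using mono[of a x] mono[of x b] that by auto
    have sin0: "sin x = 0" if x: "x \<in> {a<..<b}" for x
    proof (rule ccontr)
      assume "sin x \<noteq> 0"
      then have "2 * time_density q (peak q * (sin x)\<^sup>2) > 0"
        using arc_density_pos by simp
      moreover have "((\<lambda>_. arc_time q a) has_real_derivative 2 * time_density q (peak q * (sin x)\<^sup>2)) (at x)"
        by (rule has_field_derivative_transform_within_open[OF arc_time_props(2) _ x])
          (auto simp: const)
      ultimately show False
        using DERIV_unique[OF _ DERIV_const] by fastforce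
    qed
    define c where "c = (a + b) / 2"
    have c: "c \<in> {a<..<b}" using ab by (simp add: c_def)
    have "((\<lambda>_. 0) has_real_derivative cos c) (at c)"
      by (rule has_field_derivative_transform_within_open[OF DERIV_sin _ c]) (auto simp: sin0)
    then have "cos c = 0"
      using DERIV_unique[OF _ DERIV_const] by fastforce
    then show False
      using sin0[OF c] sin_cos_squared_add[of c] by simp
  qed
qed

lemma arc_time_less_iff: "arc_time q a < arc_time q b \<longleftrightarrow> a < b"
  using arc_time_strict_mono strict_mono_less by blast

lemma arc_time_pi_pos: "arc_time q pi > 0"
  using arc_time_less_iff[of 0 pi] arc_time_props(1) by simp

lemma arc_time_add_pi: "arc_time q (\<theta> + pi) = arc_time q \<theta> + arc_time q pi"
proof -
  have "((\<lambda>\<theta>. arc_time q (\<theta> + pi) - arc_time q \<theta>) has_real_derivative 0) (at \<theta>)" for \<theta>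
  proof -
    have "((\<lambda>\<theta>. arc_time q (\<theta> + pi)) has_real_derivative
        2 * time_density q (peak q * (sin (\<theta> + pi))\<^sup>2) * 1) (at \<theta>)"
      by (rule DERIV_chain2[OF arc_time_props(2)]) (auto intro!: derivative_eq_intros)
    then have "((\<lambda>\<theta>. arc_time q (\<theta> + pi)) has_real_derivative
        2 * time_density q (peak q * (sin \<theta>)\<^sup>2)) (at \<theta>)" by simp
    from DERIV_diff[OF this arc_time_props(2)] show ?thesis by simp
  qed
  from DERIV_isconst_all[rule_format, OF this, of \<theta> 0] show ?thesis
    by (simp add: arc_time_props(1))
qed

lemma arc_time_surj: "surj (arc_time q)"
proof -
  let ?P = "arc_time q pi"
  have up: "arc_time q (real n * pi) = real n * ?P" for n
    by (induction n) (auto simp: arc_time_props(1) distrib_right arc_time_add_pi add.commute[of pi])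
  have down: "arc_time q (- (real n * pi)) = - (real n * ?P)" for n
  proof (induction n)
    case (Suc n)
    then show ?case
      using arc_time_add_pi[of "- (real (Suc n) * pi)"] by (simp add: algebra_simps)
  qed (simp add: arc_time_props(1))
  have "\<exists>\<theta>. arc_time q \<theta> = y" for y
  proof -
    obtain n where n: "\<bar>y\<bar> < real n * ?P"
      using arc_time_pi_pos ex_less_of_nat_mult by blast
    have "\<exists>\<theta>. - (real n * pi) \<le> \<theta> \<and> \<theta> \<le> real n * pi \<and> arc_time q \<theta> = y"
      by (rule IVT) (use n up[of n] down[of n] isCont_arc_time in auto)
    then show ?thesis by blast
  qed
  then show ?thesis by (metis surj_def)
qed

lemma arc_time_phase [simp]: "arc_time q (phase q x) = x"
  unfolding phase_def using arc_time_surj by (rule surj_f_inv_f)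

lemma phase_arc_time [simp]: "phase q (arc_time q \<theta>) = \<theta>"
  unfolding phase_def using arc_time_strict_mono strict_mono_imp_inj_on by (metis inv_f_f)

lemma phase_less_iff: "phase q x < phase q y \<longleftrightarrow> x < y"
  using arc_time_less_iff[of "phase q x" "phase q y"] by simp

lemma phase_eq_iff: "phase q x = phase q y \<longleftrightarrow> x = y"
  by (metis arc_time_phase)

lemma phase_0 [simp]: "phase q 0 = 0"
  by (metis arc_time_props(1) phase_arc_time)

lemma phase_add_period: "phase q (x + arc_time q pi) = phase q x + pi"
  by (metis arc_time_add_pi arc_time_phase phase_arc_time)

lemma isCont_phase: "isCont (phase q) x"
proof -
  have "isCont (phase q) (arc_time q (phase q x))"
    by (rule isCont_inverse_function2[of "phase q x - 1" _ "phase q x + 1"]) (auto intro: isCont_arc_time)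
  then show ?thesis by simp
qed

lemma DERIV_phase:
  assumes "sin (phase q x) \<noteq> 0"
  shows "(phase q has_real_derivative inverse (2 * time_density q (profile q x))) (at x)"
proof -
  have "(arc_time q has_real_derivative 2 * time_density q (profile q x)) (at (phase q x))"
    unfolding profile_def by (rule arc_time_props(2))
  then show ?thesis
    using arc_density_pos[OF assms]
    by (intro DERIV_inverse_function[where f = "arc_time q" and a = "x - 1" and b = "x + 1"])
      (auto simp: profile_def isCont_phase)
qed

lemma profile_in: "profile q x \<in> {0..peak q}"
  unfolding profile_def by (rule peak_sin_in)

lemma isCont_profile: "isCont (profile q) x"
  unfolding profile_def[abs_def]
  by (intro continuous_intros isCont_o2[OF isCont_phase] isCont_sin)

lemma continuous_on_profile: "continuous_on A (profile q)"
  using isCont_profile continuous_at_imp_continuous_on by blast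

lemma profile_0: "profile q 0 = 0"
  by (simp add: profile_def)

lemma profile_deriv_0: "profile_deriv q 0 = 0"
  by (simp add: profile_deriv_def)

lemma profile_pos_iff: "profile q x > 0 \<longleftrightarrow> sin (phase q x) \<noteq> 0"
  using peak_pos[OF q] by (simp add: profile_def zero_less_mult_iff)

text \<open>The product \<open>s * (peak q - s)\<close> is \<open>(peak q * sin * cos)^2\<close> at
  the phase, so \<open>time_density_speed\<close> gives the claim at intermediate heights. At
  heights 0 and \<open>peak q\<close> both sides vanish.\<close>

lemma profile_deriv_sq: "(profile_deriv q x)\<^sup>2 = speed_sq q (profile q x)"
proof (cases "sin (phase q x) = 0 \<or> cos (phase q x) = 0")
  case True
  then show ?thesis
  proof
    assume "sin (phase q x) = 0"
    then show ?thesis by (simp add: profile_def profile_deriv_def speed_sq_0[OF q])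
  next
    assume c: "cos (phase q x) = 0"
    then have "(sin (phase q x))\<^sup>2 = 1" using sin_cos_squared_add[of "phase q x"] by simp
    then show ?thesis
      using c by (simp add: profile_def profile_deriv_def speed_sq_peak[OF q])
  qed
next
  case False
  let ?s = "profile q x"
  have M: "peak q - ?s = peak q * (cos (phase q x))\<^sup>2"
    by (simp add: profile_def cos_squared_eq algebra_simps)
  moreover have "peak q * (cos (phase q x))\<^sup>2 > 0"
    using False peak_pos[OF q] by simp
  ultimately have s: "0 < ?s" "?s < peak q" using False profile_pos_iff[of x] by auto
  have "(time_density q ?s)\<^sup>2 * speed_sq q ?s = peak q * (sin (phase q x))\<^sup>2 * (peak q * (cos (phase q x))\<^sup>2)"
    unfolding time_density_speed[OF q s] M by (simp add: profile_def)
  moreover have "time_density q ?s > 0"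
    using time_density_pos[OF q] s by simp
  ultimately show ?thesis
    by (simp add: profile_deriv_def field_simps power2_eq_square)
qed

lemma continuous_on_speed_profile: "continuous_on UNIV (\<lambda>x. speed_sq q (profile q x))"
  using profile_in by (intro continuous_on_compose2[OF continuous_on_speed_sq[OF q] continuous_on_profile]) auto

text \<open>At a zero of the profile the quotient defining \<open>profile_deriv\<close> may have a
  vanishing denominator; there the first integral gives
  \<open>\<bar>k'\<bar> = sqrt (speed_sq q k)\<close>, which tends to 0. Elsewhere the quotient is
  continuous as it stands.\<close>

lemma isCont_profile_deriv: "isCont (profile_deriv q) x"
proof (cases "sin (phase q x) = 0")
  case True
  then have 0: "profile_deriv q x = 0" by (simp add: profile_deriv_def)
  have "isCont (\<lambda>x. speed_sq q (profile q x)) x"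
    using continuous_on_speed_profile continuous_on_eq_continuous_at by blast
  then have "((\<lambda>x. sqrt ((profile_deriv q x)\<^sup>2)) \<longlongrightarrow> sqrt ((profile_deriv q x)\<^sup>2)) (at x)"
    unfolding profile_deriv_sq isCont_def by (rule tendsto_real_sqrt)
  then have "(profile_deriv q \<longlongrightarrow> 0) (at x)"
    using 0 by (simp add: tendsto_rabs_zero_iff)
  then show ?thesis by (simp add: isCont_def 0)
next
  case False
  have "continuous_on UNIV (\<lambda>x. time_density q (profile q x))"
    using profile_in by (intro continuous_on_compose2[OF continuous_on_time_density[OF q] continuous_on_profile]) auto
  then have "isCont (\<lambda>x. time_density q (profile q x)) x"
    using continuous_on_eq_continuous_at by blast
  moreover have "time_density q (profile q x) \<noteq> 0"
    using arc_density_pos[OF False] by (simp add: profile_def)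
  ultimately show ?thesis
    unfolding profile_deriv_def[abs_def]
    by (intro continuous_intros isCont_o2[OF isCont_phase] isCont_sin isCont_cos)
qed

text \<open>Where sin vanishes at the phase, \<open>phase\<close> need not be differentiable. Such
  points are isolated, because two distinct zeros of sin are at least pi apart, so the derivative
  there is the limit of the neighbouring ones.\<close>

lemma DERIV_profile: "(profile q has_real_derivative profile_deriv q x) (at x)"
proof -
  have regular: "(profile q has_real_derivative profile_deriv q x) (at x)" if "sin (phase q x) \<noteq> 0" for x
    unfolding profile_def[abs_def] profile_deriv_def
    using arc_density_pos[OF that]
    by (auto intro!: derivative_eq_intros DERIV_phase[OF that] simp: profile_def field_simps power2_eq_square)
  show ?thesis
  proof (cases "sin (phase q x) = 0")
    case True
    have "\<forall>\<^sub>F y in at x. dist (phase q y) (phase q x) < pi"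
      using isCont_phase[of x] tendstoD[of "phase q" "phase q x" "at x" pi] by (simp add: isCont_def)
    then have "\<forall>\<^sub>F y in at x. sin (phase q y) \<noteq> 0"
      using eventually_neq_at_within[of x x UNIV]
    proof eventually_elim
      case (elim y)
      have "phase q y - phase q x \<noteq> 0" using elim phase_eq_iff by simp
      moreover have "- pi < phase q y - phase q x" "phase q y - phase q x < pi"
        using elim by (auto simp: dist_real_def)
      ultimately have "sin (phase q y - phase q x) \<noteq> 0"
        using sin_eq_0_pi by blast
      then show ?case using True by (auto simp: sin_diff)
    qed
    then have "\<forall>\<^sub>F y in at x. (profile q has_real_derivative profile_deriv q y) (at y)"
      by eventually_elim (rule regular)
    then show ?thesis
      by (intro has_real_derivative_of_limit isCont_profile isCont_profile_deriv)
  qed (rule regular)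
qed

lemma phase_in_iff: "phase q x \<in> {0<..<pi} \<longleftrightarrow> x \<in> {0<..<arc_time q pi}"
  using phase_less_iff[of 0 x] phase_less_iff[of x "arc_time q pi"] by simp

lemma profile_pos: "x \<in> {0<..<arc_time q pi} \<Longrightarrow> profile q x > 0"
  using phase_in_iff[of x] profile_pos_iff[of x] sin_gt_zero[of "phase q x"] by auto

lemma isCont_qlog: "y > 0 \<Longrightarrow> isCont (qlog q) y"
  using continuous_on_qlog[of q] continuous_on_eq_continuous_at[of "{0::real<..}" "qlog q"] by auto

text \<open>Away from the crest \<open>profile_deriv\<close> keeps its sign locally, hence equals
  plus or minus \<open>sqrt (speed_sq q k)\<close>, which can be differentiated; this avoids any
  derivative of \<open>time_density\<close>. At the crest the square root is singular and the limit
  of derivatives takes over.\<close>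

lemma DERIV_profile_deriv:
  assumes x: "x \<in> {0<..<arc_time q pi}"
  shows "(profile_deriv q has_real_derivative - qlog q (profile q x)) (at x)"
proof -
  have regular: "(profile_deriv q has_real_derivative - qlog q (profile q x)) (at x)"
    if x: "x \<in> {0<..<arc_time q pi}" and c: "cos (phase q x) \<noteq> 0" for x
  proof -
    let ?d = "profile_deriv q x"
    have k: "profile q x > 0" using profile_pos x by simp
    then have d: "?d \<noteq> 0"
      using c peak_pos[OF q] profile_pos_iff[of x] time_density_pos[OF q, of "profile q x"] profile_in[of x]
      by (auto simp: profile_deriv_def)
    then have V: "speed_sq q (profile q x) > 0" using profile_deriv_sq[of x] by (metis zero_less_power2)
    have "\<forall>\<^sub>F y in nhds x. 0 < ?d * profile_deriv q y"
    proof -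
      have "isCont (\<lambda>y. ?d * profile_deriv q y) x"
        by (intro continuous_intros isCont_profile_deriv)
      moreover have "0 < ?d * ?d" using d by (metis not_real_square_gt_zero)
      ultimately show ?thesis
        using tendsto_at_iff_tendsto_nhds[of "\<lambda>y. ?d * profile_deriv q y" x]
          order_tendstoD(1)[of "\<lambda>y. ?d * profile_deriv q y" "?d * ?d" "nhds x" 0]
        unfolding isCont_def by blast
    qed
    then have ev: "\<forall>\<^sub>F y in nhds x. sgn ?d * sqrt (speed_sq q (profile q y)) = profile_deriv q y"
    proof eventually_elim
      case (elim y)
      then show ?case
        unfolding profile_deriv_sq[symmetric] by (auto simp: zero_less_mult_iff)
    qed
    have s: "sqrt (speed_sq q (profile q x)) = \<bar>?d\<bar>"
      unfolding profile_deriv_sq[symmetric] by simp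
    have "((\<lambda>y. sgn ?d * sqrt (speed_sq q (profile q y))) has_real_derivative
        sgn ?d * ((- 2 * qlog q (profile q x) * ?d) * (inverse (sqrt (speed_sq q (profile q x))) / 2))) (at x)"
      using k V by (auto intro!: derivative_eq_intros DERIV_speed_sq[OF q] DERIV_profile simp: q)
    moreover have "sgn ?d * ((- 2 * qlog q (profile q x) * ?d) * (inverse (sqrt (speed_sq q (profile q x))) / 2))
        = - qlog q (profile q x)"
      unfolding s using d by (auto simp: sgn_if)
    ultimately show ?thesis
      using DERIV_cong_ev[OF refl ev refl] by metis
  qed
  show ?thesis
  proof (cases "cos (phase q x) = 0")
    case True
    have half: "phase q y = pi / 2" if "y \<in> {0<..<arc_time q pi}" "cos (phase q y) = 0" for y
      using that phase_in_iff[of y] cos_inj_pi[of "phase q y" "pi / 2"] by simp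
    have "\<forall>\<^sub>F y in at x. y \<in> {0<..<arc_time q pi}"
      by (rule eventually_at_in_open'[OF _ x]) simp
    then have "\<forall>\<^sub>F y in at x. (profile_deriv q has_real_derivative - qlog q (profile q y)) (at y)"
      using eventually_neq_at_within[of x x UNIV]
    proof eventually_elim
      case (elim y)
      have "cos (phase q y) \<noteq> 0"
        using half[of y] half[of x] elim x True phase_eq_iff[of x y] by auto
      then show ?case using regular elim by blast
    qed
    moreover have "isCont (\<lambda>x. - qlog q (profile q x)) x"
      using profile_pos[OF x] by (intro continuous_intros isCont_o2[OF isCont_profile] isCont_qlog)
    ultimately show ?thesis
      by (intro has_real_derivative_of_limit isCont_profile_deriv)
  qed (rule regular[OF x])
qed

lemma is_zero_angle_profile_profile: "is_zero_angle_profile q (profile q) (arc_time q pi)"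
proof -
  have "least_period (profile q) (arc_time q pi)"
    unfolding least_period_def
  proof (intro conjI allI impI notI)
    show "profile q (x + arc_time q pi) = profile q x" for x
      by (simp add: profile_def phase_add_period)
    \<comment> \<open>A smaller period would repeat the zero at 0 in the interior of the arc, where
      the profile is positive.\<close>
    fix T assume T: "0 < T \<and> T < arc_time q pi" "\<forall>x. profile q (x + T) = profile q x"
    from T(2)[rule_format, of 0] have "profile q T = 0" by (simp add: profile_def)
    then show False using profile_pos[of T] T(1) by simp
  qed (rule arc_time_pi_pos)
  moreover have "continuous_on UNIV (profile_deriv q)"
    using isCont_profile_deriv continuous_at_imp_continuous_on by blast
  ultimately show ?thesis
    unfolding is_zero_angle_profile_def profile_equation_iff
    by (intro conjI exI[of _ "profile_deriv q"])
      (auto simp: DERIV_profile DERIV_profile_deriv profile_pos profile_0 profile_deriv_0)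
qed

end

section \<open>Uniqueness of the profile\<close>

text \<open>The time at which the rising branch reaches height y:
  \<open>y = peak q * (sin \<theta>)^2\<close> is solved for \<theta> between 0 and pi/2. It is an
  antiderivative of \<open>1 / sqrt (speed_sq q y)\<close> that stays continuous at both ends of the
  height range.\<close>

definition travel_time :: "real \<Rightarrow> real \<Rightarrow> real" where
  "travel_time q y = arc_time q (arcsin (sqrt (y / peak q)))"

lemma travel_time_0: "-1 < q \<Longrightarrow> travel_time q 0 = 0"
  by (simp add: travel_time_def arc_time_props(1))

lemma continuous_on_travel_time:
  assumes q: "-1 < q"
  shows "continuous_on {0..peak q} (travel_time q)"
proof -
  have "continuous_on UNIV (arc_time q)"
    using isCont_arc_time[OF q] continuous_at_imp_continuous_on by blast
  moreover have "-1 \<le> sqrt (y / peak q) \<and> sqrt (y / peak q) \<le> 1" if "y \<in> {0..peak q}" for y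
  proof -
    have "0 \<le> sqrt (y / peak q)" "sqrt (y / peak q) \<le> 1"
      using that peak_pos[OF q] by auto
    then show ?thesis by linarith
  qed
  moreover from this have "continuous_on {0..peak q} (\<lambda>y. arcsin (sqrt (y / peak q)))"
    using peak_pos[OF q] by (intro continuous_on_arcsin continuous_intros) auto
  ultimately show ?thesis
    unfolding travel_time_def[abs_def] by (auto intro: continuous_on_compose2[of UNIV "arc_time q" _ "\<lambda>y. arcsin (sqrt (y / peak q))"])
qed

lemma travel_time_inj:
  assumes q: "-1 < q"
  shows "inj_on (travel_time q) {0..peak q}"
proof (rule inj_onI)
  fix x y assume xy: "x \<in> {0..peak q}" "y \<in> {0..peak q}" "travel_time q x = travel_time q y"
  have "arcsin (sqrt (x / peak q)) = arcsin (sqrt (y / peak q))"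
    using xy(3) arc_time_strict_mono[OF q] by (simp add: travel_time_def strict_mono_eq)
  moreover have "\<bar>sqrt (z / peak q)\<bar> \<le> 1" if "z \<in> {0..peak q}" for z
    using that peak_pos[OF q] by auto
  ultimately have "sqrt (x / peak q) = sqrt (y / peak q)"
    using arcsin_eq_iff xy(1,2) by blast
  then have "x / peak q = y / peak q" by (simp only: real_sqrt_eq_iff)
  then show "x = y" using peak_pos[OF q] by simp
qed

lemma DERIV_travel_time:
  assumes q: "-1 < q" and y: "0 < y" "y < peak q"
  shows "(travel_time q has_real_derivative 1 / sqrt (speed_sq q y)) (at y)"
proof -
  let ?M = "peak q"
  have M: "?M > 0" using peak_pos[OF q] .
  let ?u = "sqrt (y / ?M)"
  have u: "0 < ?u" "?u < 1" using y M by auto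
  have u2: "?u\<^sup>2 = y / ?M" using y M by simp
  have w: "peak q * (sin (arcsin ?u))\<^sup>2 = y"
  proof -
    have "sin (arcsin ?u) = ?u" using u by (intro sin_arcsin) linarith+
    then show ?thesis using u2 M by simp
  qed
  have "(arc_time q has_real_derivative 2 * time_density q y) (at (arcsin ?u))"
    using arc_time_props(2)[OF q, of "arcsin ?u"] w by simp
  moreover have "((\<lambda>y. arcsin (sqrt (y / ?M))) has_real_derivative
      inverse (sqrt (1 - ?u\<^sup>2)) * (1 / ?M * (inverse ?u / 2))) (at y)"
  proof (rule DERIV_chain2[where g = "\<lambda>y. sqrt (y / ?M)"])
    show "(arcsin has_real_derivative inverse (sqrt (1 - ?u\<^sup>2))) (at ?u)"
      using u by (intro DERIV_arcsin) linarith+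
    have "((\<lambda>y. y / ?M) has_real_derivative 1 / ?M) (at y)"
      using M by (auto intro!: derivative_eq_intros)
    moreover have "y / ?M > 0" using y M by simp
    ultimately have "((\<lambda>y. sqrt (y / ?M)) has_real_derivative (inverse ?u / 2) * (1 / ?M)) (at y)"
      by (intro DERIV_chain2[OF DERIV_real_sqrt])
    then show "((\<lambda>y. sqrt (y / ?M)) has_real_derivative 1 / ?M * (inverse ?u / 2)) (at y)"
      by (simp only: mult.commute)
  qed
  ultimately have "(travel_time q has_real_derivative
      (2 * time_density q y) * (inverse (sqrt (1 - ?u\<^sup>2)) * (1 / ?M * (inverse ?u / 2)))) (at y)"
    unfolding travel_time_def[abs_def] by (rule DERIV_chain2)
  moreover have "(2 * time_density q y) * (inverse (sqrt (1 - ?u\<^sup>2)) * (1 / ?M * (inverse ?u / 2)))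
      = 1 / sqrt (speed_sq q y)"
  \<comment> \<open>Both sides are nonnegative, so it suffices to compare squares, the form in which
    \<open>time_density_speed\<close> is available.\<close>
  proof (rule power2_eq_imp_eq)
    have V: "speed_sq q y > 0" using speed_sq_pos[OF q y] .
    have d: "1 - y / ?M > 0" using y M by simp
    have 1: "(2 * time_density q y) * (inverse (sqrt (1 - ?u\<^sup>2)) * (1 / ?M * (inverse ?u / 2)))
        = time_density q y * inverse (sqrt (1 - y / ?M) * ?M * ?u)"
      unfolding u2 by (simp only: divide_inverse inverse_mult_distrib) algebra
    have 2: "(1 - y / ?M) * ?M\<^sup>2 * (y / ?M) = y * (?M - y)"
      using M by (simp add: field_simps power2_eq_square)
    have 3: "(time_density q y)\<^sup>2 * inverse (y * (?M - y)) = 1 / speed_sq q y"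
    proof -
      have "c \<noteq> 0 \<Longrightarrow> v \<noteq> 0 \<Longrightarrow> t * v = c \<Longrightarrow> t * inverse c = 1 / v" for t c v :: real
        by (auto simp: field_simps)
      then show ?thesis
        using time_density_speed[OF q y] y V by (metis (no_types) diff_gt_0_iff_gt less_irrefl mult_pos_pos)
    qed
    have "(time_density q y * inverse (sqrt (1 - y / ?M) * ?M * ?u))\<^sup>2
        = (time_density q y)\<^sup>2 * inverse ((1 - y / ?M) * ?M\<^sup>2 * (y / ?M))"
      unfolding power_mult_distrib power_inverse u2 using d by simp
    then show "((2 * time_density q y) * (inverse (sqrt (1 - ?u\<^sup>2)) * (1 / ?M * (inverse ?u / 2))))\<^sup>2
        = (1 / sqrt (speed_sq q y))\<^sup>2"
      unfolding 1 2 3 using V by (simp add: power_divide)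
    show "0 \<le> (2 * time_density q y) * (inverse (sqrt (1 - ?u\<^sup>2)) * (1 / ?M * (inverse ?u / 2)))"
      using u M time_density_pos[OF q, of y] y u2 d by (intro mult_nonneg_nonneg) auto
    show "0 \<le> 1 / sqrt (speed_sq q y)" using V by simp
  qed
  ultimately show ?thesis by simp
qed

text \<open>A single positive arc, with derivatives required only inside and continuity up to the
  ends. One period of any candidate for \<open>k0\<close> and any rescaled droplet are both
  instances, so one uniqueness result serves the definition of \<open>k0\<close> and the
  classification of droplets.\<close>

locale zero_angle_arc =
  fixes q P :: real and k k' :: "real \<Rightarrow> real"
  assumes q: "-1 < q" and P: "0 < P"
    and cont: "continuous_on {0..P} k" and cont': "continuous_on {0..P} k'"
    and k_0: "k 0 = 0" and k_P: "k P = 0" and k'_0: "k' 0 = 0"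
    and pos: "\<And>x. x \<in> {0<..<P} \<Longrightarrow> k x > 0"
    and der: "\<And>x. x \<in> {0<..<P} \<Longrightarrow> (k has_real_derivative k' x) (at x)"
    and der': "\<And>x. x \<in> {0<..<P} \<Longrightarrow> (k' has_real_derivative - qlog q (k x)) (at x)"
begin

lemma nonneg:
  assumes "x \<in> {0..P}"
  shows "k x \<ge> 0"
proof -
  consider "x = 0" | "x = P" | "x \<in> {0<..<P}" using assms by force
  then show ?thesis using pos[of x] k_0 k_P by cases auto
qed

text \<open>The difference of the two sides has derivative 0 inside the arc. Continuity of
  \<open>speed_sq q\<close> at height 0 allows its constant value to be taken at the contact point,
  where it is 0.\<close>

lemma first_integral:
  assumes "x \<in> {0..P}"
  shows "(k' x)\<^sup>2 = speed_sq q (k x)"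
proof -
  let ?F = "\<lambda>x. (k' x)\<^sup>2 - speed_sq q (k x)"
  have "continuous_on {0..P} ?F"
    using nonneg
    by (intro continuous_intros cont' continuous_on_compose2[OF continuous_on_speed_sq[OF q] cont]) auto
  moreover have "(?F has_real_derivative 0) (at x)" if "x \<in> {0<..<P}" for x
    using that pos[OF that] by (auto intro!: derivative_eq_intros DERIV_speed_sq[OF q] der der' simp: q)
  ultimately have "?F x = ?F 0"
    using P assms by (intro DERIV_isconst2[of 0 P]) auto
  then show ?thesis by (simp add: k_0 k'_0 speed_sq_0[OF q])
qed

lemma le_peak: "x \<in> {0..P} \<Longrightarrow> k x \<le> peak q"
  using first_integral[of x] speed_sq_neg[OF q, of "k x"] zero_le_power2[of "k' x"] by force

lemma critical: "x \<in> {0<..<P} \<Longrightarrow> k' x = 0 \<Longrightarrow> k x = peak q"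
  using first_integral[of x] speed_sq_eq_0_iff[OF q pos[of x]] by auto

text \<open>Critical points lie at the maximal height \<open>peak q\<close>. Between two of them the
  minimum of k would be attained at a critical point too, so k would be constant there, although k''
  = -1 at that height.\<close>

lemma critical_unique:
  assumes "c \<in> {0<..<P}" "d \<in> {0<..<P}" "k' c = 0" "k' d = 0"
  shows "c = d"
proof -
  have no: False if cd: "c < d" and c: "c \<in> {0<..<P}" "k' c = 0" and d: "d \<in> {0<..<P}" "k' d = 0" for c d
  proof -
    have "continuous_on {c..d} k"
      using c d by (intro continuous_on_subset[OF cont]) auto
    then obtain e where e: "e \<in> {c..d}" "\<And>x. x \<in> {c..d} \<Longrightarrow> k e \<le> k x"
      using continuous_attains_inf[of "{c..d}" k] cd by auto
    have "k e = peak q"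
    proof (cases "e \<in> {c<..<d}")
      case True
      then have eP: "e \<in> {0<..<P}" using c d by auto
      have "k' e = 0"
      proof (rule DERIV_local_min[OF der[OF eP]])
        show "0 < min (e - c) (d - e)" using True by simp
        show "\<forall>y. \<bar>e - y\<bar> < min (e - c) (d - e) \<longrightarrow> k e \<le> k y"
          by (auto intro!: e(2))
      qed
      then show ?thesis using critical eP by blast
    next
      case False
      then have "e = c \<or> e = d" using e(1) by auto
      then show ?thesis using critical c d by auto
    qed
    then have const: "k x = peak q" if "x \<in> {c..d}" for x
      using le_peak[of x] e(2)[OF that] that c d by auto
    have zero: "k' x = 0" if x: "x \<in> {c<..<d}" for x
    proof -
      have "((\<lambda>_. peak q) has_real_derivative k' x) (at x)"
        by (rule has_field_derivative_transform_within_open[OF der _ x]) (use x c d in \<open>auto simp: const\<close>)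
      then show ?thesis using DERIV_unique DERIV_const by blast
    qed
    define z where "z = (c + d) / 2"
    have z: "z \<in> {c<..<d}" using cd by (simp add: z_def)
    have "((\<lambda>_. 0) has_real_derivative - qlog q (k z)) (at z)"
      by (rule has_field_derivative_transform_within_open[OF der' _ z]) (use z c d in \<open>auto simp: zero\<close>)
    then have "- qlog q (k z) = 0" using DERIV_unique DERIV_const by blast
    then show False using const[of z] z qlog_peak[OF q] by simp
  qed
  show ?thesis
    using no[of c d] no[of d c] assms by (cases c d rule: linorder_cases) auto
qed

lemma slope_witness:
  assumes "0 \<le> x" "x < y" "y \<le> P"
  obtains z where "z \<in> {x<..<y}" "k y - k x = (y - x) * k' z"
proof -
  have "\<exists>l z. x < z \<and> z < y \<and> DERIV k z :> l \<and> k y - k x = (y - x) * l"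
    using assms cont der by (intro MVT continuous_on_subset[OF cont]) (auto simp: real_differentiable_def intro!: exI der)
  then obtain l z where "x < z" "z < y" "DERIV k z :> l" "k y - k x = (y - x) * l" by blast
  moreover have "l = k' z"
    using DERIV_unique[OF \<open>DERIV k z :> l\<close> der] calculation assms by auto
  ultimately show ?thesis using that by auto
qed

lemma k'_zero_between:
  assumes "x \<in> {0<..<P}" "y \<in> {0<..<P}" "k' x * k' y \<le> 0" "x \<le> y"
  obtains z where "z \<in> {x..y}" "k' z = 0"
proof -
  have c: "continuous_on {x..y} k'"
    using assms by (intro continuous_on_subset[OF cont']) auto
  show ?thesis
  proof (cases "k' x \<le> 0")
    case True
    show ?thesis
    proof (cases "k' y \<ge> 0")
      case True
      then show ?thesis using IVT'[of k' x 0 y] c assms \<open>k' x \<le> 0\<close> that by auto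
    next
      case False
      then have "k' x = 0" using True assms(3) by (auto simp: mult_le_0_iff)
      then show ?thesis using that assms by auto
    qed
  next
    case False
    then have "k' y \<le> 0" using assms(3) by (auto simp: mult_le_0_iff)
    then show ?thesis using IVT2'[of k' y 0 x] c assms False that by auto
  qed
qed

definition crest :: real where
  "crest = (SOME c. c \<in> {0<..<P} \<and> k' c = 0)"

lemma crest: "crest \<in> {0<..<P}" "k' crest = 0" "k crest = peak q"
proof -
  have "\<exists>z. 0 < z \<and> z < P \<and> DERIV k z :> 0"
    using P cont der k_0 k_P by (intro Rolle) (auto simp: real_differentiable_def)
  then have "\<exists>c. c \<in> {0<..<P} \<and> k' c = 0"
    using der DERIV_unique by (metis greaterThanLessThan_iff)
  from someI_ex[OF this] show *: "crest \<in> {0<..<P}" "k' crest = 0"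
    unfolding crest_def by blast+
  then show "k crest = peak q" using critical by blast
qed

text \<open>Since k rises from 0, the mean value theorem gives a positive slope somewhere before x;
  a nonpositive slope at x would then create a critical point other than the crest.\<close>

lemma k'_pos: 
  assumes "x \<in> {0<..<crest}"
  shows "k' x > 0"
proof (rule ccontr)
  assume n: "\<not> ?thesis"
  have x: "x \<in> {0<..<P}" using assms crest by auto
  obtain z where z: "z \<in> {0<..<x}" "k x - k 0 = (x - 0) * k' z"
    using slope_witness[of 0 x] x by auto
  then have "k' z > 0" using pos[OF x] k_0 x by (simp add: zero_less_mult_iff)
  then obtain w where "w \<in> {z..x}" "k' w = 0"
    using k'_zero_between[of z x] z x n by (auto simp: mult_le_0_iff)
  then show False
    using critical_unique[of w crest] crest z assms by auto
qed

lemma k'_neg: 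
  assumes "x \<in> {crest<..<P}"
  shows "k' x < 0"
proof (rule ccontr)
  assume n: "\<not> ?thesis"
  have x: "x \<in> {0<..<P}" using assms crest by auto
  obtain z where z: "z \<in> {x<..<P}" "k P - k x = (P - x) * k' z"
    using slope_witness[of x P] x by auto
  then have "(P - x) * k' z < 0" using pos[OF x] k_P by simp
  then have "k' z < 0" using x by (simp add: mult_less_0_iff)
  then obtain w where "w \<in> {x..z}" "k' w = 0"
    using k'_zero_between[of x z] z x n by (auto simp: mult_le_0_iff)
  then show False
    using critical_unique[of w crest] crest z assms by auto
qed

lemma less_peak:
  assumes "x \<in> {0<..<P}" "x \<noteq> crest"
  shows "k x < peak q"
proof -
  have "k' x \<noteq> 0" using critical_unique[of x crest] crest assms by blast
  then have "k x \<noteq> peak q"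
    using first_integral[of x] assms by (auto simp: speed_sq_peak[OF q])
  then show ?thesis using le_peak[of x] assms by auto
qed

lemma sqrt_speed: "x \<in> {0..P} \<Longrightarrow> sqrt (speed_sq q (k x)) = \<bar>k' x\<bar>"
  using first_integral[of x] by (metis real_sqrt_abs)

text \<open>Quadrature with the height as variable: \<open>\<Phi> (k x)\<close> has derivative
  \<open>g (k x)\<close> times the sign of \<open>k' x\<close>, which is constant on each side of
  the crest. The interior form of the fundamental theorem is used since \<Phi> is differentiable
  only at heights strictly between 0 and the peak. The choice g = 1 gives travel times, g = id the
  area.\<close>

lemma arc_integral:
  fixes g \<Phi> :: "real \<Rightarrow> real"
  assumes \<Phi>: "continuous_on {0..peak q} \<Phi>"
    and D\<Phi>: "\<And>y. 0 < y \<Longrightarrow> y < peak q \<Longrightarrow> (\<Phi> has_real_derivative g y / sqrt (speed_sq q y)) (at y)"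
  shows "x \<in> {0..crest} \<Longrightarrow> ((\<lambda>x. g (k x)) has_integral \<Phi> (k x) - \<Phi> 0) {0..x}"
    and "x \<in> {crest..P} \<Longrightarrow> ((\<lambda>x. g (k x)) has_integral \<Phi> (k x) - \<Phi> 0) {x..P}"
proof -
  have contF: "continuous_on {0..P} (\<lambda>x. \<Phi> (k x))"
    using nonneg le_peak by (intro continuous_on_compose2[OF \<Phi> cont]) auto
  have D: "((\<lambda>x. \<Phi> (k x)) has_real_derivative g (k z) / \<bar>k' z\<bar> * k' z) (at z)"
    if "z \<in> {0<..<P}" "z \<noteq> crest" for z
    using DERIV_chain2[OF D\<Phi>[OF pos less_peak] der, of z] that sqrt_speed[of z] by auto
  show "((\<lambda>x. g (k x)) has_integral \<Phi> (k x) - \<Phi> 0) {0..x}" if x: "x \<in> {0..crest}"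
  proof -
    have "((\<lambda>x. g (k x)) has_integral \<Phi> (k x) - \<Phi> (k 0)) {0..x}"
    proof (rule fundamental_theorem_of_calculus_interior)
      show "continuous_on {0..x} (\<lambda>x. \<Phi> (k x))"
        using x crest by (intro continuous_on_subset[OF contF]) auto
      show "((\<lambda>x. \<Phi> (k x)) has_vector_derivative g (k z)) (at z)" if z: "z \<in> {0<..<x}" for z
      proof -
        have "k' z > 0" using z x by (intro k'_pos) auto
        then show ?thesis
          using D[of z] z x crest by (simp add: has_real_derivative_iff_has_vector_derivative)
      qed
    qed (use x in auto)
    then show ?thesis by (simp add: k_0)
  qed
  show "((\<lambda>x. g (k x)) has_integral \<Phi> (k x) - \<Phi> 0) {x..P}" if x: "x \<in> {crest..P}"
  proof -
    have "((\<lambda>x. g (k x)) has_integral - \<Phi> (k P) - - \<Phi> (k x)) {x..P}"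
    proof (rule fundamental_theorem_of_calculus_interior)
      show "continuous_on {x..P} (\<lambda>x. - \<Phi> (k x))"
        using x crest by (intro continuous_on_minus continuous_on_subset[OF contF]) auto
      show "((\<lambda>x. - \<Phi> (k x)) has_vector_derivative g (k z)) (at z)" if z: "z \<in> {x<..<P}" for z
      proof -
        have "k' z < 0" using z x by (intro k'_neg) auto
        then have "- (g (k z) / \<bar>k' z\<bar> * k' z) = g (k z)" by simp
        moreover have "((\<lambda>x. - \<Phi> (k x)) has_real_derivative - (g (k z) / \<bar>k' z\<bar> * k' z)) (at z)"
          using z x crest by (intro DERIV_minus D) auto
        ultimately show ?thesis
          by (simp add: has_real_derivative_iff_has_vector_derivative)
      qed
    qed (use x in auto)
    then show ?thesis by (simp add: k_P)
  qed
qed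

lemma travel_time_k:
  "x \<in> {0..crest} \<Longrightarrow> travel_time q (k x) = x"
  "x \<in> {crest..P} \<Longrightarrow> travel_time q (k x) = P - x"
proof -
  have *: "((\<lambda>x. 1) has_integral travel_time q (k x) - travel_time q 0) {0..x}" if "x \<in> {0..crest}" for x
    using arc_integral(1)[OF continuous_on_travel_time[OF q], of "\<lambda>_. 1"] DERIV_travel_time[OF q] that by simp
  show "travel_time q (k x) = x" if "x \<in> {0..crest}"
    using has_integral_unique[OF *[OF that] has_integral_const_real[of 1 0 x]] that travel_time_0[OF q] by simp
  have *: "((\<lambda>x. 1) has_integral travel_time q (k x) - travel_time q 0) {x..P}" if "x \<in> {crest..P}" for x
    using arc_integral(2)[OF continuous_on_travel_time[OF q], of "\<lambda>_. 1"] DERIV_travel_time[OF q] that by simp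
  show "travel_time q (k x) = P - x" if "x \<in> {crest..P}"
    using has_integral_unique[OF *[OF that] has_integral_const_real[of 1 x P]] that travel_time_0[OF q] by simp
qed

lemma crest_eq: "crest = travel_time q (peak q)"
  using travel_time_k(1)[of crest] crest by simp

lemma P_eq: "P = 2 * travel_time q (peak q)"
  using travel_time_k(2)[of crest] crest crest_eq by simp

lemma has_integral_arc:
  fixes g \<Phi> :: "real \<Rightarrow> real"
  assumes "continuous_on {0..peak q} \<Phi>"
    and "\<And>y. 0 < y \<Longrightarrow> y < peak q \<Longrightarrow> (\<Phi> has_real_derivative g y / sqrt (speed_sq q y)) (at y)"
  shows "((\<lambda>x. g (k x)) has_integral 2 * (\<Phi> (peak q) - \<Phi> 0)) {0..P}"
  using has_integral_combine[OF _ _ arc_integral(1)[OF assms, of crest] arc_integral(2)[OF assms, of crest]] crest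
  by simp

end

text \<open>The period is twice the travel time to the peak, so it depends on q only. At each x both
  heights have the same travel time, and travel time determines the height.\<close>

lemma zero_angle_arc_unique:
  assumes "zero_angle_arc q P1 k1 k1'" "zero_angle_arc q P2 k2 k2'"
  shows "P1 = P2" "x \<in> {0..P1} \<Longrightarrow> k1 x = k2 x"
proof -
  interpret a: zero_angle_arc q P1 k1 k1' by fact
  interpret b: zero_angle_arc q P2 k2 k2' by fact
  show P: "P1 = P2" using a.P_eq b.P_eq by simp
  have c: "a.crest = b.crest" using a.crest_eq b.crest_eq by simp
  assume x: "x \<in> {0..P1}"
  have "travel_time q (k1 x) = travel_time q (k2 x)"
    using a.travel_time_k[of x] b.travel_time_k[of x] x P c by (cases "x \<le> a.crest") auto
  moreover have "k1 x \<in> {0..peak q}" "k2 x \<in> {0..peak q}"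
    using a.nonneg[OF x] a.le_peak[OF x] b.nonneg[of x] b.le_peak[of x] x P by simp_all
  ultimately show "k1 x = k2 x"
    by (rule inj_onD[OF travel_time_inj[OF a.q]])
qed

section \<open>From one arc to the periodic profile: the definite descriptions \<open>k0\<close> and
  \<open>P0\<close>\<close>

lemma periodic_shift:
  fixes k :: "real \<Rightarrow> 'a" and n :: int
  assumes "\<And>x. k (x + P) = k x"
  shows "k (x + of_int n * P) = k x"
proof -
  have nat: "k (x + of_nat m * P) = k x" for m x
  proof (induction m)
    case (Suc m)
    have "x + of_nat (Suc m) * P = (x + of_nat m * P) + P" by (simp add: distrib_right)
    then show ?case using assms Suc by metis
  qed simp
  show ?thesis
  proof (cases "n \<ge> 0")
    case True
    then show ?thesis using nat[of x "nat n"] by simp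
  next
    case False
    then show ?thesis using nat[of "x + of_int n * P" "nat (- n)"] by simp
  qed
qed

lemma periodic_representative:
  fixes x P :: real
  assumes "P > 0"
  obtains n :: int and r where "x = r + of_int n * P" "r \<in> {0..<P}"
proof
  show "x = P * frac (x / P) + of_int \<lfloor>x / P\<rfloor> * P"
    using assms by (simp add: frac_def field_simps)
  show "P * frac (x / P) \<in> {0..<P}"
    using assms frac_lt_1[of "x / P"] frac_ge_0[of "x / P"] by simp
qed

lemma zero_angle_arc_of_profile:
  assumes q: "-1 < q" and "is_zero_angle_profile q k P"
  shows "\<exists>k'. zero_angle_arc q P k k'"
proof -
  obtain k' where k': "\<And>x. (k has_real_derivative k' x) (at x)" "continuous_on UNIV k'" "k 0 = 0" "k' 0 = 0"
      "\<And>x. x \<in> {0<..<P} \<Longrightarrow> k x > 0 \<and> profile_equation q k k' x"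
    and P: "least_period k P"
    using assms(2) unfolding is_zero_angle_profile_def by blast
  have "k P = 0" using P k'(3) unfolding least_period_def by (metis add_0)
  moreover have "continuous_on {0..P} k"
    using k'(1) by (intro DERIV_continuous_on) (auto intro: has_field_derivative_at_within)
  ultimately have "zero_angle_arc q P k k'"
    using q k' P continuous_on_subset[OF k'(2)]
    unfolding profile_equation_iff least_period_def by unfold_locales auto
  then show ?thesis by blast
qed

lemma k0_P0_eq:
  assumes q: "-1 < q"
  shows "k0 q = profile q" "P0 q = arc_time q pi"
proof -
  note ex = is_zero_angle_profile_profile[OF q]
  have uniq: "k = profile q \<and> P = arc_time q pi" if kP: "is_zero_angle_profile q k P" for k P
  proof -
    obtain k' where a: "zero_angle_arc q P k k'" using zero_angle_arc_of_profile[OF q kP] by blast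
    obtain k2' where b: "zero_angle_arc q (arc_time q pi) (profile q) k2'"
      using zero_angle_arc_of_profile[OF q ex] by blast
    note u = zero_angle_arc_unique[OF a b]
    have per: "k (x + P) = k x" "profile q (x + P) = profile q x" "P > 0" for x
      using kP ex u(1) by (auto simp: is_zero_angle_profile_def least_period_def)
    have "k x = profile q x" for x
    proof -
      obtain n :: int and r where r: "x = r + of_int n * P" "r \<in> {0..<P}"
        using periodic_representative[OF per(3)] .
      have "k x = k r" "profile q x = profile q r"
        unfolding r(1) by (rule periodic_shift; rule per)+
      then show ?thesis using u(2)[of r] r(2) by simp
    qed
    then show ?thesis using u(1) by auto
  qed
  show k: "k0 q = profile q"
    unfolding k0_def using ex uniq by (intro the_equality) blast+
  show "P0 q = arc_time q pi"
    unfolding P0_def k using ex uniq by (intro the_equality) blast+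
qed

lemma zero_angle_arc_k0:
  assumes "-1 < q"
  shows "zero_angle_arc q (P0 q) (k0 q) (profile_deriv q)"
proof -
  interpret b: zero_angle_arc q "P0 q" "k0 q" "SOME k'. zero_angle_arc q (P0 q) (k0 q) k'"
    using someI_ex[OF zero_angle_arc_of_profile[OF assms is_zero_angle_profile_profile[OF assms]]]
    by (simp add: k0_P0_eq[OF assms])
  show ?thesis
    using b.cont b.k_0 b.k_P b.pos b.P
      isCont_profile_deriv[OF assms] DERIV_profile[OF assms] DERIV_profile_deriv[OF assms] profile_deriv_0[OF assms]
    by unfold_locales (auto simp: assms k0_P0_eq[OF assms] continuous_at_imp_continuous_on)
qed

section \<open>Droplets are rescaled profiles\<close>

text \<open>With \<open>h = l * k ((x - a) / w)\<close> the second derivative carries the factor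
  \<open>l / w^2\<close>, while \<open>B * qlog q h\<close> has the nonconstant part
  \<open>B * l powr q * qlog q k\<close>; w is chosen so that the two factors agree.\<close>

definition width_scale :: "real \<Rightarrow> real \<Rightarrow> real \<Rightarrow> real" where
  "width_scale q B l = sqrt (l powr (1 - q) / B)"

lemma width_scale_pos: "B > 0 \<Longrightarrow> l > 0 \<Longrightarrow> width_scale q B l > 0"
  by (simp add: width_scale_def)

lemma width_scale_sq:
  assumes "B > 0" "l > 0"
  shows "(width_scale q B l)\<^sup>2 * B * l powr q = l"
proof -
  have "l powr (1 - q) * l powr q = l" using assms by (simp add: powr_add[symmetric])
  then show ?thesis using assms by (simp add: width_scale_def)
qed

text \<open>The crossing is the largest element of the compact set where f is at most e. Choosing
  the last one keeps f above e all the way to c.\<close>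

lemma last_crossing:
  fixes f :: "real \<Rightarrow> real"
  assumes f: "continuous_on {a..c} f" and ac: "a < c" and e: "f a < e" "e < f c"
  obtains x where "x \<in> {a<..<c}" "f x = e" "\<And>y. y \<in> {x..c} \<Longrightarrow> e \<le> f y"
proof -
  let ?S = "{a..c} \<inter> f -` {..e}"
  have "closed ?S" using f by (intro continuous_closed_preimage) auto
  then have "compact ?S" by (intro compact_Int_closed[of "{a..c}" ?S, simplified inf.left_idem]) auto
  moreover have "a \<in> ?S" using ac e by auto
  ultimately obtain x where x: "x \<in> ?S" "\<And>y. y \<in> ?S \<Longrightarrow> y \<le> x"
    using compact_attains_sup[of ?S] by blast
  have above: "e < f y" if "y \<in> {x<..c}" for y
    using x(2)[of y] x(1) that by force
  have "f x = e"
  proof (rule ccontr)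
    assume "f x \<noteq> e"
    then have "f x \<le> e" "f x \<noteq> e" using x(1) by auto
    moreover have "continuous_on {x..c} f" using x(1) by (intro continuous_on_subset[OF f]) auto
    ultimately obtain y where "x \<le> y" "y \<le> c" "f y = e"
      using IVT'[of f x e c] e x(1) by auto
    then show False using above[of y] \<open>f x \<noteq> e\<close> by (cases "y = x") auto
  qed
  moreover have "e \<le> f y" if "y \<in> {x..c}" for y
    using above[of y] that \<open>f x = e\<close> by (cases "y = x") auto
  moreover have "x \<in> {a<..<c}"
    using x(1) \<open>f x = e\<close> e by (cases "x = a"; cases "x = c") auto
  ultimately show ?thesis using that by blast
qed

lemma first_crossing:
  fixes f :: "real \<Rightarrow> real"
  assumes f: "continuous_on {c..b} f" and cb: "c < b" and e: "f b < e" "e < f c"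
  obtains x where "x \<in> {c<..<b}" "f x = e" "\<And>y. y \<in> {c..x} \<Longrightarrow> e \<le> f y"
proof -
  have "continuous_on {-b..-c} (\<lambda>x. f (- x))"
    by (intro continuous_on_compose2[OF f] continuous_intros) auto
  then obtain x where x: "x \<in> {-b<..<-c}" "f (- x) = e" "\<And>y. y \<in> {x..-c} \<Longrightarrow> e \<le> f (- y)"
    using last_crossing[of "-b" "-c" "\<lambda>x. f (- x)" e] cb e by auto
  show ?thesis
  proof (rule that[of "- x"])
    show "e \<le> f y" if "y \<in> {c..- x}" for y
      using x(3)[of "- y"] that by auto
  qed (use x in auto)
qed

section \<open>A steady state that meets zero with zero slope has no flux and is a rescaled
  profile\<close>

locale touchdown_steady_state =
  fixes m n q B a b :: real and h h1 h2 h3 :: "real \<Rightarrow> real"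
  assumes q: "-1 < q" and B: "0 < B" and q_eq: "q = m - n + 1" and ab: "a < b"
    and pos: "\<And>x. x \<in> {a<..<b} \<Longrightarrow> h x > 0"
    and h_ends: "h a = 0" "h b = 0"
    and cont: "continuous_on {a..b} h" and cont1: "continuous_on {a..b} h1"
    and h1_ends: "h1 a = 0" "h1 b = 0"
    and der: "\<And>x. x \<in> {a<..<b} \<Longrightarrow> (h has_real_derivative h1 x) (at x)"
    and der1: "\<And>x. x \<in> {a<..<b} \<Longrightarrow> (h1 has_real_derivative h2 x) (at x)"
    and der2: "\<And>x. x \<in> {a<..<b} \<Longrightarrow> (h2 has_real_derivative h3 x) (at x)"
    and flux: "\<And>x. x \<in> {a<..<b} \<Longrightarrow>
      ((\<lambda>y. h y powr n * h3 y + B * h y powr m * h1 y) has_real_derivative 0) (at x)"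
begin

definition C :: real where
  "C = h ((a + b) / 2) powr n * h3 ((a + b) / 2) + B * h ((a + b) / 2) powr m * h1 ((a + b) / 2)"

lemma flux_eq: "x \<in> {a<..<b} \<Longrightarrow> h x powr n * h3 x + B * h x powr m * h1 x = C"
  unfolding C_def using ab
  by (rule DERIV_isconst3[of a b _ _ "\<lambda>y. h y powr n * h3 y + B * h y powr m * h1 y"]) (auto intro: flux)

definition pressure :: "real \<Rightarrow> real" where
  "pressure x = h2 x + B * qlog q (h x)"

text \<open>This is the flux equation divided by \<open>h powr n\<close>, where
  \<open>m - n = q - 1\<close>.\<close>

lemma DERIV_pressure:
  assumes x: "x \<in> {a<..<b}"
  shows "(pressure has_real_derivative C * h x powr (- n)) (at x)"
proof -
  have "(pressure has_real_derivative h3 x + B * (h x powr (q - 1) * h1 x)) (at x)"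
    unfolding pressure_def[abs_def] using pos[OF x]
    by (auto intro!: derivative_eq_intros der2[OF x] der[OF x])
  moreover have "h3 x + B * (h x powr (q - 1) * h1 x) = C * h x powr (- n)"
  proof -
    have "h x powr n * h x powr (- n) = 1" "h x powr m * h x powr (- n) = h x powr (q - 1)"
      using pos[OF x] by (auto simp: powr_add[symmetric] q_eq)
    then show ?thesis unfolding flux_eq[OF x, symmetric] distrib_right
      by (simp add: algebra_simps)
  qed
  ultimately show ?thesis by simp
qed

text \<open>Subtracting the level \<open>e\<close> makes the pressure drop out at the points where \<open>h = e\<close>; near the
  contact points nothing is known about the pressure itself.\<close>

definition level_energy :: "real \<Rightarrow> real \<Rightarrow> real" where
  "level_energy e x = (h1 x)\<^sup>2 / 2 - B / 2 * speed_sq q (h x) - pressure x * (h x - e)"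

text \<open>Multiplication by C turns the derivative into \<open>- C^2\<close> times a positive
  factor times \<open>h - e\<close>. Its sign where h \<ge> e is thus known for either sign of C and
  for every exponent n.\<close>

lemma DERIV_level_energy:
  assumes x: "x \<in> {a<..<b}"
  shows "((\<lambda>x. C * level_energy e x) has_real_derivative - (C\<^sup>2 * h x powr (- n) * (h x - e))) (at x)"
proof -
  have "((\<lambda>x. C * level_energy e x) has_real_derivative
      C * (h1 x * h2 x + B * qlog q (h x) * h1 x
        - (C * h x powr (- n) * (h x - e) + h1 x * pressure x))) (at x)"
    unfolding level_energy_def using pos[OF x] q
    by (auto intro!: derivative_eq_intros DERIV_speed_sq der1[OF x] der[OF x] DERIV_pressure[OF x])
  also have "C * (h1 x * h2 x + B * qlog q (h x) * h1 x
        - (C * h x powr (- n) * (h x - e) + h1 x * pressure x)) = - (C\<^sup>2 * h x powr (- n) * (h x - e))"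
    by (simp add: pressure_def algebra_simps power2_eq_square)
  finally show ?thesis .
qed

lemma level_energy_antimono:
  assumes "x \<in> {a<..<b}" "y \<in> {a<..<b}" "x \<le> y" "\<And>z. z \<in> {x..y} \<Longrightarrow> e \<le> h z"
  shows "C * level_energy e y \<le> C * level_energy e x"
proof (rule DERIV_nonpos_imp_nonincreasing[OF assms(3)])
  fix z assume z: "x \<le> z" "z \<le> y"
  then have "z \<in> {a<..<b}" using assms by auto
  moreover have "- (C\<^sup>2 * h z powr (- n) * (h z - e)) \<le> 0" using assms(4)[of z] z by simp
  ultimately show "\<exists>d. ((\<lambda>x. C * level_energy e x) has_real_derivative d) (at z) \<and> d \<le> 0"
    using DERIV_level_energy by blast
qed

text \<open>If C were nonzero, \<open>C * level_energy 0\<close> would drop by some \<delta> > 0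
  between two fixed inner points c and d. Passing to a small level e changes this drop by at most e
  K, and monotonicity extends the drop outward to points \<alpha> and \<beta> where h = e. These lie
  near the contact points, where h' is small, so the drop between them is less than \<delta>/2, a
  contradiction.\<close>

lemma C_eq_0: "C = 0"
proof (rule ccontr)
  assume C: "C \<noteq> 0"
  define c where "c = (2 * a + b) / 3"
  define d where "d = (a + 2 * b) / 3"
  have cd: "a < c" "c < d" "d < b" using ab by (auto simp: c_def d_def)
  define \<delta> where "\<delta> = C * level_energy 0 c - C * level_energy 0 d"
  have "C * level_energy 0 d < C * level_energy 0 c"
  proof (rule DERIV_neg_imp_decreasing[OF cd(2)])
    fix z assume z: "c \<le> z" "z \<le> d"
    then have z: "z \<in> {a<..<b}" using cd by auto
    then have "- (C\<^sup>2 * h z powr (- n) * (h z - 0)) < 0" using pos[OF z] C by simp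
    then show "\<exists>y. ((\<lambda>x. C * level_energy 0 x) has_real_derivative y) (at z) \<and> y < 0"
      using DERIV_level_energy z by blast
  qed
  then have \<delta>: "\<delta> > 0" by (simp add: \<delta>_def)
  have "continuous_on {a..b} (\<lambda>x. \<bar>C\<bar> / 2 * (h1 x)\<^sup>2)"
    by (intro continuous_intros cont1)
  then have small: "\<exists>\<eta>>0. \<forall>x\<in>{a..b}. dist x s < \<eta> \<longrightarrow> \<bar>C\<bar> / 2 * (h1 x)\<^sup>2 < \<delta> / 4"
    if "s \<in> {a..b}" "h1 s = 0" for s
  proof -
    from \<open>continuous_on {a..b} _\<close> that(1) \<delta>
    obtain \<eta> where "\<eta> > 0" "\<And>x. x \<in> {a..b} \<Longrightarrow> dist x s < \<eta> \<Longrightarrow>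
        dist (\<bar>C\<bar> / 2 * (h1 x)\<^sup>2) (\<bar>C\<bar> / 2 * (h1 s)\<^sup>2) < \<delta> / 4"
      unfolding continuous_on_iff by (metis divide_pos_pos zero_less_numeral)
    then show ?thesis using that(2) by (intro exI[of _ \<eta>]) (auto simp: dist_real_def)
  qed
  obtain \<eta>1 where \<eta>1: "\<eta>1 > 0" "\<And>x. x \<in> {a..b} \<Longrightarrow> dist x a < \<eta>1 \<Longrightarrow> \<bar>C\<bar> / 2 * (h1 x)\<^sup>2 < \<delta> / 4"
    using small[of a] h1_ends ab by auto
  obtain \<eta>2 where \<eta>2: "\<eta>2 > 0" "\<And>x. x \<in> {a..b} \<Longrightarrow> dist x b < \<eta>2 \<Longrightarrow> \<bar>C\<bar> / 2 * (h1 x)\<^sup>2 < \<delta> / 4"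
    using small[of b] h1_ends ab by auto
  \<comment> \<open>The third bound keeps c and d inside the inner interval, since they are the
    points that cut the droplet into thirds.\<close>
  define \<eta> where "\<eta> = min (min \<eta>1 \<eta>2) ((b - a) / 3)"
  have \<eta>: "0 < \<eta>" "\<eta> \<le> \<eta>1" "\<eta> \<le> \<eta>2" "\<eta> \<le> (b - a) / 3" 
    using \<eta>1(1) \<eta>2(1) ab unfolding \<eta>_def by (simp_all only: min_le_iff_disj min_less_iff_conj) auto
  have cd_in: "c \<in> {a + \<eta>..b - \<eta>}" "d \<in> {a + \<eta>..b - \<eta>}"
    using \<eta>(4) ab by (auto simp: c_def d_def)
  have "continuous_on {a + \<eta>..b - \<eta>} h" using \<eta> by (intro continuous_on_subset[OF cont]) auto
  then obtain z where z: "z \<in> {a + \<eta>..b - \<eta>}" "\<And>x. x \<in> {a + \<eta>..b - \<eta>} \<Longrightarrow> h z \<le> h x"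
    using continuous_attains_inf[of "{a + \<eta>..b - \<eta>}" h] cd_in by auto
  have hz: "h z > 0" using pos[of z] z(1) \<eta>(1) by auto
  define K where "K = \<bar>C * (pressure c - pressure d)\<bar>"
  \<comment> \<open>The first bound places e below the minimum of h on the inner interval, so that
    the crossings fall into the outer strips of width \<eta>; the second gives e K < \<delta>/2. The
    summand 1 keeps the denominator positive if K = 0.\<close>
  define e where "e = min (h z / 2) (\<delta> / (2 * (K + 1)))"
  have K: "K \<ge> 0" by (simp add: K_def)
  have e: "e > 0" "e < h z" using hz \<delta> K by (auto simp: e_def)
  have eK: "e * K < \<delta> / 2"
  proof -
    have "e * K \<le> \<delta> / (2 * (K + 1)) * K" using K by (intro mult_right_mono) (auto simp: e_def)
    also have "\<dots> < \<delta> / 2" using K \<delta> by (simp add: field_simps)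
    finally show ?thesis .
  qed
  obtain \<alpha> where \<alpha>: "\<alpha> \<in> {a<..<c}" "h \<alpha> = e" "\<And>y. y \<in> {\<alpha>..c} \<Longrightarrow> e \<le> h y"
  proof (rule last_crossing[of a c h e])
    show "continuous_on {a..c} h" using cd by (intro continuous_on_subset[OF cont]) auto
    show "e < h c" using e(2) z(2)[OF cd_in(1)] by linarith
  qed (use cd h_ends e in auto)
  obtain \<beta> where \<beta>: "\<beta> \<in> {d<..<b}" "h \<beta> = e" "\<And>y. y \<in> {d..\<beta>} \<Longrightarrow> e \<le> h y"
  proof (rule first_crossing[of d b h e])
    show "continuous_on {d..b} h" using cd by (intro continuous_on_subset[OF cont]) auto
    show "e < h d" using e(2) z(2)[OF cd_in(2)] by linarith
  qed (use cd h_ends e in auto)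
  have "\<alpha> < a + \<eta>"
  proof (rule ccontr)
    assume "\<not> ?thesis"
    then have "\<alpha> \<in> {a + \<eta>..b - \<eta>}" using \<alpha>(1) cd_in(1) by auto
    then show False using z(2)[of \<alpha>] \<alpha>(2) e by simp
  qed
  then have 1: "\<bar>C\<bar> / 2 * (h1 \<alpha>)\<^sup>2 < \<delta> / 4"
    using \<eta>1(2)[of \<alpha>] \<alpha>(1) cd \<eta> by (auto simp: dist_real_def)
  have "\<beta> > b - \<eta>"
  proof (rule ccontr)
    assume "\<not> ?thesis"
    then have "\<beta> \<in> {a + \<eta>..b - \<eta>}" using \<beta>(1) cd_in(2) by auto
    then show False using z(2)[of \<beta>] \<beta>(2) e by simp
  qed
  then have 2: "\<bar>C\<bar> / 2 * (h1 \<beta>)\<^sup>2 < \<delta> / 4"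
    using \<eta>2(2)[of \<beta>] \<beta>(1) cd \<eta> by (auto simp: dist_real_def)
  have "C * level_energy e c \<le> C * level_energy e \<alpha>"
    using \<alpha> cd by (intro level_energy_antimono) auto
  moreover have "C * level_energy e \<beta> \<le> C * level_energy e d"
    using \<beta> cd by (intro level_energy_antimono) auto
  \<comment> \<open>Both points have height e: the pressure terms vanish and the values of
    \<open>speed_sq q e\<close> cancel, so only the slopes remain.\<close>
  moreover have "C * level_energy e \<alpha> - C * level_energy e \<beta> = C / 2 * (h1 \<alpha>)\<^sup>2 - C / 2 * (h1 \<beta>)\<^sup>2"
    by (simp add: level_energy_def \<alpha> \<beta> algebra_simps)
  moreover have "C / 2 * (h1 \<alpha>)\<^sup>2 \<le> \<bar>C\<bar> / 2 * (h1 \<alpha>)\<^sup>2" "- (C / 2 * (h1 \<beta>)\<^sup>2) \<le> \<bar>C\<bar> / 2 * (h1 \<beta>)\<^sup>2"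
    using mult_right_mono[of C "\<bar>C\<bar>" "(h1 \<alpha>)\<^sup>2 / 2"] mult_right_mono[of "- C" "\<bar>C\<bar>" "(h1 \<beta>)\<^sup>2 / 2"] by simp_all
  moreover have "C * level_energy e c - C * level_energy e d = \<delta> + e * (C * (pressure c - pressure d))"
    by (simp add: level_energy_def \<delta>_def algebra_simps)
  moreover have "e * (C * (pressure c - pressure d)) \<ge> - (e * K)"
    using mult_left_mono[of "- K" "C * (pressure c - pressure d)" e] e(1) by (simp add: K_def)
  ultimately show False using 1 2 eK by linarith
qed

definition D :: real where
  "D = pressure ((a + b) / 2)"

lemma h2_eq: "x \<in> {a<..<b} \<Longrightarrow> h2 x = D - B * qlog q (h x)"
proof -
  assume x: "x \<in> {a<..<b}"
  have "pressure x = D"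
    unfolding D_def using ab x DERIV_pressure C_eq_0
    by (intro DERIV_isconst3[of a b _ _ pressure]) auto
  then show ?thesis by (simp add: pressure_def)
qed

lemma energy_eq:
  assumes "x \<in> {a..b}"
  shows "(h1 x)\<^sup>2 / 2 - B / 2 * speed_sq q (h x) = D * h x"
proof -
  let ?F = "\<lambda>x. (h1 x)\<^sup>2 / 2 - B / 2 * speed_sq q (h x) - D * h x"
  have nonneg: "0 \<le> h y" if "y \<in> {a..b}" for y
    using pos[of y] h_ends that by (cases "y = a"; cases "y = b") auto
  have "continuous_on {a..b} (\<lambda>x. speed_sq q (h x))"
    using nonneg by (intro continuous_on_compose2[OF continuous_on_speed_sq[OF q] cont]) auto
  then have "continuous_on {a..b} ?F"
    by (intro continuous_intros cont cont1) auto
  moreover have "(?F has_real_derivative 0) (at x)" if x: "x \<in> {a<..<b}" for x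
  proof -
    have "(?F has_real_derivative h1 x * h2 x + B * qlog q (h x) * h1 x - D * h1 x) (at x)"
      using pos[OF x] q by (auto intro!: derivative_eq_intros DERIV_speed_sq der[OF x] der1[OF x])
    then show ?thesis by (simp add: h2_eq[OF x] algebra_simps)
  qed
  ultimately have "?F x = ?F a"
    using ab assms by (intro DERIV_isconst2[of a b]) auto
  then show ?thesis by (simp add: h_ends h1_ends speed_sq_0[OF q])
qed

text \<open>For q other than 0 the range of \<open>qlog q\<close> is bounded on one side, so not
  every constant has this form. A critical point z supplies l: comparing \<open>h z\<close> with the
  peak of the profile suggests \<open>l = h z / peak q\<close>, and the first integral at z then
  gives D.\<close>

lemma scale_exists: "\<exists>l>0. D = B * qlog q l"
proof -
  have "\<exists>z. a < z \<and> z < b \<and> DERIV h z :> 0"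
    using ab cont der h_ends by (intro Rolle) (auto simp: real_differentiable_def intro!: exI der)
  then obtain z where z: "z \<in> {a<..<b}" "h1 z = 0"
    using der DERIV_unique by (metis greaterThanLessThan_iff)
  let ?M = "peak q"
  define l where "l = h z / ?M"
  have M: "?M > 0" and hz: "h z > 0" using peak_pos[OF q] pos z by auto
  then have l: "l > 0" by (simp add: l_def)
  have "qlog q (h z) = l powr q + qlog q l"
    using qlog_mult[OF l M, of q] M qlog_peak[OF q] by (simp add: l_def)
  then have hz': "qlog q (h z) = 1 + (q + 1) * qlog q l"
    using powr_eq_qlog[OF l, of q] by (simp add: algebra_simps)
  have "D * h z = - B / 2 * speed_sq q (h z)"
    using energy_eq[of z] z by simp
  also have "speed_sq q (h z) = - (2 * h z * qlog q l)"
    unfolding speed_sq_def hz' using q by (simp add: field_simps)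
  finally have "D * h z = (B * qlog q l) * h z" by simp
  then show ?thesis using hz l by auto
qed

lemma rescaled_k0:
  obtains l where "l > 0" "b - a = width_scale q B l * P0 q"
    "\<And>x. x \<in> {a..b} \<Longrightarrow> h x = l * k0 q ((x - a) / width_scale q B l)"
proof -
  obtain l where l: "l > 0" "D = B * qlog q l" using scale_exists by blast
  let ?w = "width_scale q B l"
  have w: "?w > 0" using width_scale_pos[OF B l(1)] .
  have inside: "a + ?w * x \<in> {a<..<b}" if "x \<in> {0<..<(b - a) / ?w}" for x
    using that w by (auto simp: field_simps)
  have inside': "a + ?w * x \<in> {a..b}" if "x \<in> {0..(b - a) / ?w}" for x
    using that w by (auto simp: field_simps)
  have arc: "zero_angle_arc q ((b - a) / ?w) (\<lambda>x. h (a + ?w * x) / l) (\<lambda>x. ?w / l * h1 (a + ?w * x))"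
  proof
    show "continuous_on {0..(b - a) / ?w} (\<lambda>x. h (a + ?w * x) / l)"
      using inside' l by (intro continuous_intros continuous_on_compose2[OF cont]) auto
    show "continuous_on {0..(b - a) / ?w} (\<lambda>x. ?w / l * h1 (a + ?w * x))"
      using inside' by (intro continuous_intros continuous_on_compose2[OF cont1]) auto
    fix x assume x: "x \<in> {0<..<(b - a) / ?w}"
    show "0 < h (a + ?w * x) / l" using pos[OF inside[OF x]] l by simp
    have lin: "((\<lambda>x. a + ?w * x) has_real_derivative ?w) (at x)" by (auto intro!: derivative_eq_intros)
    show "((\<lambda>x. h (a + ?w * x) / l) has_real_derivative ?w / l * h1 (a + ?w * x)) (at x)"
      using DERIV_cdivide[OF DERIV_chain2[OF der[OF inside[OF x]] lin], of l] by (simp add: field_simps)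
    let ?k = "h (a + ?w * x) / l"
    \<comment> \<open>Here D = B qlog(l) cancels the additive term, so the rescaled function
      satisfies the profile equation without a constant.\<close>
    have "qlog q (h (a + ?w * x)) = l powr q * qlog q ?k + qlog q l"
      using qlog_mult[OF l(1), of ?k q] pos[OF inside[OF x]] l by simp
    then have "h2 (a + ?w * x) = - (B * l powr q * qlog q ?k)"
      using h2_eq[OF inside[OF x]] l(2) by (simp add: algebra_simps)
    then have "?w / l * (h2 (a + ?w * x) * ?w) = - (?w\<^sup>2 * B * l powr q / l * qlog q ?k)"
      by (simp add: power2_eq_square)
    also have "\<dots> = - qlog q ?k"
      unfolding width_scale_sq[OF B l(1)] using l by simp
    finally show "((\<lambda>x. ?w / l * h1 (a + ?w * x)) has_real_derivative - qlog q ?k) (at x)"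
      using DERIV_cmult[OF DERIV_chain2[OF der1[OF inside[OF x]] lin], of "?w / l"] by simp
  qed (use q ab w h_ends h1_ends in auto)
  note u = zero_angle_arc_unique[OF arc zero_angle_arc_k0[OF q]]
  show ?thesis
  proof (rule that[OF l(1)])
    show "b - a = ?w * P0 q" using u(1) w by (simp add: field_simps)
    show "h x = l * k0 q ((x - a) / ?w)" if "x \<in> {a..b}" for x
    proof -
      have "(x - a) / ?w \<in> {0..(b - a) / ?w}" using that w by (auto simp: divide_right_mono)
      from u(2)[OF this] show ?thesis using w l by (simp add: field_simps)
    qed
  qed
qed

end

section \<open>From the definition of a droplet to the rescaled profile\<close>

lemma DERIV_within_Icc_unique:
  fixes f :: "real \<Rightarrow> real"
  assumes "a < b" "x \<in> {a..b}"
    "(f has_real_derivative u) (at x within {a..b})" "(f has_real_derivative v) (at x within {a..b})"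
  shows "u = v"
proof -
  have "(f has_vector_derivative u) (at x within cbox a b)" "(f has_vector_derivative v) (at x within cbox a b)"
    using assms by (auto simp: has_real_derivative_iff_has_vector_derivative)
  then show ?thesis
    using vector_derivative_unique_within_closed_interval[of a b x f u v] assms by auto
qed

lemma zero_angle_droplet_is_rescaled_k0:
  assumes q: "-1 < q" "q = m - n + 1" and B: "0 < B"
    and drop: "droplet_steady_state m n B a b h" and zero: "zero_contact_angle a b h"
  obtains l where "l > 0" "b - a = width_scale q B l * P0 q"
    "\<And>x. x \<in> {a..b} \<Longrightarrow> h x = l * k0 q ((x - a) / width_scale q B l)"
proof -
  have ab: "a < b" and pos: "\<And>x. x \<in> {a<..<b} \<Longrightarrow> h x > 0" and out: "\<And>x. x \<notin> {a<..<b} \<Longrightarrow> h x = 0"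
    using drop by (auto simp: droplet_steady_state_def)
  obtain h' where h': "\<And>x. x \<in> {a..b} \<Longrightarrow> (h has_real_derivative h' x) (at x within {a..b})"
      "continuous_on {a..b} h'"
    using drop unfolding droplet_steady_state_def by blast
  obtain h1 h2 h3 where st: "\<And>x. x \<in> {a<..<b} \<Longrightarrow> (h has_real_derivative h1 x) (at x)"
      "\<And>x. x \<in> {a<..<b} \<Longrightarrow> (h1 has_real_derivative h2 x) (at x)"
      "\<And>x. x \<in> {a<..<b} \<Longrightarrow> (h2 has_real_derivative h3 x) (at x)"
      "\<And>x. x \<in> {a<..<b} \<Longrightarrow> ((\<lambda>y. h y powr n * h3 y + B * h y powr m * h1 y) has_real_derivative 0) (at x)"
    using drop unfolding droplet_steady_state_def steady_state_on_def by blast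
  have h'_ends: "h' a = 0" "h' b = 0"
    using DERIV_within_Icc_unique[OF ab _ h'(1), of a 0] DERIV_within_Icc_unique[OF ab _ h'(1), of b 0]
      zero ab by (auto simp: zero_contact_angle_def)
  \<comment> \<open>The slope from the closed interval and the one from the interior equation agree
    inside, so \<open>h'\<close> can replace \<open>h1\<close> in the equation and brings continuity
    up to the contact points.\<close>
  have eq: "h1 x = h' x" if "x \<in> {a<..<b}" for x
    using DERIV_within_Icc_unique[OF ab, of x h] that h'(1)[of x]
      has_field_derivative_at_within[OF st(1)[OF that]] by auto
  have "touchdown_steady_state m n q B a b h h' h2 h3"
  proof
    show "continuous_on {a..b} h" using h'(1) by (rule DERIV_continuous_on)
    show "(h has_real_derivative h' x) (at x)" if "x \<in> {a<..<b}" for x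
      using st(1)[OF that] eq[OF that] by simp
    show "(h' has_real_derivative h2 x) (at x)" if "x \<in> {a<..<b}" for x
      by (rule has_field_derivative_transform_within_open[OF st(2)[OF that] _ that]) (auto simp: eq)
    show "((\<lambda>y. h y powr n * h3 y + B * h y powr m * h' y) has_real_derivative 0) (at x)"
      if "x \<in> {a<..<b}" for x
      by (rule has_field_derivative_transform_within_open[OF st(4)[OF that] _ that]) (auto simp: eq)
  qed (use q B ab pos out h' h'_ends st in auto)
  then interpret touchdown_steady_state m n q B a b h h' h2 h3 .
  show ?thesis by (rule rescaled_k0) (rule that)
qed

section \<open>Area and energy\<close>

lemma has_integral_rescale:
  fixes f :: "real \<Rightarrow> real"
  assumes "(f has_integral I) {0..P}" "w > 0"
  shows "((\<lambda>x. f ((x - a) / w)) has_integral w * I) {a..a + w * P}"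
proof -
  have "((\<lambda>x. f ((1 / w) *\<^sub>R x + (- a / w))) has_integral (I /\<^sub>R (1 / w) ^ DIM(real)))
      (cbox ((0 - (- a / w)) /\<^sub>R (1 / w)) ((P - (- a / w)) /\<^sub>R (1 / w)))"
    using assms by (intro has_integral_affinity') auto
  moreover have "(0 - (- a / w)) /\<^sub>R (1 / w) = a" "(P - (- a / w)) /\<^sub>R (1 / w) = a + w * P"
    "I /\<^sub>R (1 / w) ^ DIM(real) = w * I" "(1 / w) *\<^sub>R x + (- a / w) = (x - a) / w" for x
    using assms(2) by (auto simp: field_simps)
  ultimately show ?thesis by simp
qed

lemma has_integral_shift:
  fixes f :: "real \<Rightarrow> real"
  assumes "(f has_integral I) {a..b}"
  shows "((\<lambda>x. f (x + c)) has_integral I) {a - c..b - c}"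
  using has_integral_affinity'[of f I a b 1 c] assms by simp

text \<open>After a shift by whole periods the interval starts at some r in [0, X); the piece beyond
  X is then moved back by one period.\<close>

lemma has_integral_periodic:
  fixes f :: "real \<Rightarrow> real"
  assumes per: "\<And>x. f (x + X) = f x" and X: "X > 0" and int: "(f has_integral I) {a..a + X}"
  shows "(f has_integral I) {0..X}"
proof -
  obtain n :: int and r where r: "a = r + of_int n * X" "r \<in> {0..<X}"
    using periodic_representative[OF X] .
  have "((\<lambda>x. f (x + of_int n * X)) has_integral I) {a - of_int n * X..a + X - of_int n * X}"
    using int by (rule has_integral_shift)
  moreover have "(\<lambda>x. f (x + of_int n * X)) = f"
    using periodic_shift[of f X] per by auto
  ultimately have int: "(f has_integral I) {r..r + X}"
    using r(1) by (simp add: algebra_simps)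
  have "f integrable_on {r..X}" "f integrable_on {X..r + X}"
    using r(2) by (auto intro: integrable_subinterval_real[OF has_integral_integrable[OF int]])
  then obtain I1 I2 where I: "(f has_integral I1) {r..X}" "(f has_integral I2) {X..r + X}"
    by (auto simp: integrable_on_def)
  have "(f has_integral I1 + I2) {r..r + X}"
    using r(2) by (intro has_integral_combine[OF _ _ I]) auto
  then have "I1 + I2 = I" using int by (rule has_integral_unique)
  moreover have "(f has_integral I2) {0..r}"
    using has_integral_shift[OF I(2), of X] per by simp
  then have "(f has_integral I2 + I1) {0..X}"
    using r(2) by (intro has_integral_combine[OF _ _ _ I(1)]) auto
  ultimately show ?thesis by (simp add: add.commute)
qed

text \<open>Separates the potential energy of a rescaled profile into a multiple of
  \<open>k'^2\<close> and a multiple of k, the two quantities whose integrals over a period are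
  known.\<close>

lemma speed_sq_mult:
  assumes q: "-1 < q" and l: "0 < l" and y: "0 \<le> y"
  shows "speed_sq q (l * y) = l powr q * l * speed_sq q y - 2 * l * y * qlog q l"
proof (cases "y = 0")
  case False
  then have y: "y > 0" using y by simp
  have *: "l powr q = 1 + q * qlog q l" using powr_eq_qlog[OF l] .
  have "1 - qlog q (l * y) = l powr q * (1 - qlog q y) - (q + 1) * qlog q l"
    unfolding qlog_mult[OF l y] * by (simp add: algebra_simps)
  then have "speed_sq q (l * y) = 2 * (l * y) * (l powr q * (1 - qlog q y) - (q + 1) * qlog q l) / (q + 1)"
    by (simp add: speed_sq_def)
  also have "\<dots> = l powr q * l * (2 * y * (1 - qlog q y) / (q + 1)) - 2 * l * y * qlog q l"
    using q by (simp add: diff_divide_distrib right_diff_distrib mult_ac)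
  finally show ?thesis by (simp only: speed_sq_def)
qed (use q in \<open>simp add: speed_sq_0\<close>)

text \<open>\<open>- (B / 2) * speed_sq q\<close> has second derivative
  \<open>B * y powr (q - 1)\<close>, so H differs from it by an affine function. That part
  contributes equally to any two states of the same area on the same circle.\<close>

lemma energy_density_eq:
  assumes q: "-1 < q" and H: "energy_density B q H"
  obtains \<alpha> \<beta> where "\<And>y. y \<ge> 0 \<Longrightarrow> H y = - (B / 2) * speed_sq q y + \<alpha> * y + \<beta>"
proof -
  obtain H' where cont: "continuous_on {0..} H"
    and H': "\<And>y. y > 0 \<Longrightarrow> (H has_real_derivative H' y) (at y)"
      "\<And>y. y > 0 \<Longrightarrow> (H' has_real_derivative B * y powr (q - 1)) (at y)"
    using H unfolding energy_density_def by blast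
  have const: "H' y - B * qlog q y = H' 1 - B * qlog q 1" if "y > 0" for y
  proof (rule DERIV_isconst3[of 0 "max y 1 + 1" _ _ "\<lambda>y. H' y - B * qlog q y"])
    show "((\<lambda>y. H' y - B * qlog q y) has_real_derivative 0) (at x)" if "x \<in> {0<..<max y 1 + 1}" for x
      using that by (auto intro!: derivative_eq_intros H')
  qed (use that in auto)
  define \<alpha> where "\<alpha> = H' 1 - B * qlog q 1"
  let ?F = "\<lambda>y. H y + (B / 2) * speed_sq q y - \<alpha> * y"
  have "?F y = ?F 0" if y: "y > 0" for y
  proof (rule DERIV_isconst2[of 0 y])
    show "continuous_on {0..y} ?F"
      by (intro continuous_intros continuous_on_subset[OF cont]
          continuous_on_subset[OF continuous_on_speed_sq[OF q]]) auto
    show "(?F has_real_derivative 0) (at x)" if "0 < x" for x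
    proof -
      have "(?F has_real_derivative H' x + B / 2 * (- 2 * qlog q x * 1) - \<alpha> * 1) (at x)"
        by (rule DERIV_diff DERIV_add DERIV_cmult DERIV_speed_sq[OF q] H' DERIV_ident that)+
      then show ?thesis using const[OF that] by (simp add: \<alpha>_def)
    qed
  qed (use y in auto)
  then have "H y = - (B / 2) * speed_sq q y + \<alpha> * y + H 0" if "y \<ge> 0" for y
    using that by (cases "y = 0") (auto simp: speed_sq_0[OF q] algebra_simps)
  then show ?thesis using that by blast
qed

lemma energy_const: "X > 0 \<Longrightarrow> energy H X (\<lambda>_. c) = - X * H c"
  by (simp add: energy_def)

context
  fixes q :: real
  assumes q: "-1 < q"
begin

interpretation k: zero_angle_arc q "P0 q" "k0 q" "profile_deriv q"
  by (rule zero_angle_arc_k0[OF q])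

lemma P0_pos: "0 < P0 q"
  by (rule k.P)

lemma has_integral_k0: "(k0 q has_integral A0 q) {0..P0 q}"
  unfolding A0_def by (intro integrable_integral integrable_continuous_real k.cont)

lemma A0_pos: "0 < A0 q"
proof -
  have "A0 q \<ge> 0" unfolding A0_def using k.nonneg k.cont
    by (intro integral_nonneg integrable_continuous_real) auto
  moreover have "A0 q \<noteq> 0"
  proof
    assume "A0 q = 0"
    moreover have "P0 q / 2 \<in> {0<..<P0 q}" using k.P by simp
    ultimately have "k0 q (P0 q / 2) = 0"
      using integral_eq_0_iff[OF k.cont k.P k.nonneg] unfolding A0_def by simp
    then show False using k.pos[of "P0 q / 2"] k.P by simp
  qed
  ultimately show ?thesis by simp
qed

text \<open>Integrates \<open>(k k')' = (q + 3) / 2 * k'\<^sup>2 - k\<close> over the period.\<close>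

lemma has_integral_k0_deriv_sq:
  "((\<lambda>x. (profile_deriv q x)\<^sup>2) has_integral 2 / (q + 3) * A0 q) {0..P0 q}"
proof -
  have "((\<lambda>x. (q + 3) / 2 * (profile_deriv q x)\<^sup>2 - k0 q x) has_integral
      k0 q (P0 q) * profile_deriv q (P0 q) - k0 q 0 * profile_deriv q 0) {0..P0 q}"
  proof (rule fundamental_theorem_of_calculus_interior)
    show "continuous_on {0..P0 q} (\<lambda>x. k0 q x * profile_deriv q x)"
      by (intro continuous_intros k.cont k.cont')
    fix x assume x: "x \<in> {0<..<P0 q}"
    have "((\<lambda>x. k0 q x * profile_deriv q x) has_real_derivative
        profile_deriv q x * profile_deriv q x + - qlog q (k0 q x) * k0 q x) (at x)"
      by (rule DERIV_mult'[OF k.der[OF x] k.der'[OF x], THEN DERIV_cong]) simp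
    moreover have "(q + 1) / 2 * (profile_deriv q x)\<^sup>2 = k0 q x * (1 - qlog q (k0 q x))"
      using k.first_integral[of x] x q by (simp add: speed_sq_def)
    then have "profile_deriv q x * profile_deriv q x + - qlog q (k0 q x) * k0 q x
        = (q + 3) / 2 * (profile_deriv q x)\<^sup>2 - k0 q x"
      by (simp add: power2_eq_square field_simps)
    ultimately show "((\<lambda>x. k0 q x * profile_deriv q x) has_vector_derivative
        (q + 3) / 2 * (profile_deriv q x)\<^sup>2 - k0 q x) (at x)"
      by (simp only: has_real_derivative_iff_has_vector_derivative)
  qed (use k.P in simp)
  then have "((\<lambda>x. (q + 3) / 2 * (profile_deriv q x)\<^sup>2 - k0 q x) has_integral 0) {0..P0 q}"
    by (simp add: k.k_0 k.k_P)
  from has_integral_add[OF this has_integral_k0]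
  have "((\<lambda>x. (q + 3) / 2 * (profile_deriv q x)\<^sup>2) has_integral A0 q) {0..P0 q}"
    by simp
  from has_integral_mult_right[OF this, of "2 / (q + 3)"] show ?thesis
    using q by simp
qed

end

context
  fixes q B l :: real
  assumes q: "-1 < q" and B: "0 < B" and l: "0 < l"
begin

interpretation k: zero_angle_arc q "P0 q" "k0 q" "profile_deriv q"
  by (rule zero_angle_arc_k0[OF q])

lemma area_eq:
  assumes "b - a = width_scale q B l * P0 q"
    and "\<And>x. x \<in> {a..b} \<Longrightarrow> h x = l * k0 q ((x - a) / width_scale q B l)"
  shows "integral {a..b} h = l * width_scale q B l * A0 q"
proof -
  have b: "b = a + width_scale q B l * P0 q" using assms(1) by simp
  have "((\<lambda>x. l * k0 q ((x - a) / width_scale q B l)) has_integral l * (width_scale q B l * A0 q)) {a..b}"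
    unfolding b by (intro has_integral_mult_right has_integral_rescale has_integral_k0[OF q] width_scale_pos B l)
  then have "(h has_integral l * (width_scale q B l * A0 q)) {a..b}"
    by (rule has_integral_eq[rotated]) (simp add: assms(2))
  then show ?thesis by (simp add: integral_unique)
qed

lemma DERIV_rescaled_k0:
  "((\<lambda>x. l * k0 q ((x - a) / w)) has_real_derivative l / w * profile_deriv q ((x - a) / w)) (at x)"
proof -
  have "((\<lambda>x. (x - a) / w) has_real_derivative 1 / w) (at x)"
    by (cases "w = 0") (auto intro!: derivative_eq_intros)
  from DERIV_cmult[OF DERIV_chain2[OF DERIV_profile[OF q] this], of l] show ?thesis
    by (simp add: k0_P0_eq[OF q])
qed

lemma droplet_exists:
  fixes m n :: real
  assumes q_eq: "q = m - n + 1"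
  defines "w \<equiv> width_scale q B l"
  shows "\<exists>h. droplet_steady_state m n B 0 (w * P0 q) h \<and> zero_contact_angle 0 (w * P0 q) h \<and>
    integral {0..w * P0 q} h = l * w * A0 q"
proof -
  let ?b = "w * P0 q"
  let ?g = "\<lambda>x. l * k0 q ((x - 0) / w)"
  let ?h1 = "\<lambda>x. l / w * profile_deriv q ((x - 0) / w)"
  define h where "h = (\<lambda>x. if x \<in> {0<..<?b} then ?g x else 0)"
  have w: "w > 0" unfolding w_def by (intro width_scale_pos B l)
  have b: "?b > 0" using w k.P by simp
  have hg: "h x = ?g x" if "x \<in> {0..?b}" for x
  proof -
    have "?g 0 = 0" "?g ?b = 0" using w by (auto simp: k.k_0 k.k_P)
    then show ?thesis using that by (auto simp: h_def)
  qed
  have inside: "(x - 0) / w \<in> {0<..<P0 q}" if "x \<in> {0<..<?b}" for x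
    using that w by (auto simp: field_simps)
  have gpos: "?g x > 0" if "x \<in> {0<..<?b}" for x
    using k.pos[OF inside[OF that]] l by simp
  have dh: "(h has_real_derivative ?h1 x) (at x within {0..?b})" if x: "x \<in> {0..?b}" for x
    using has_field_derivative_at_within[OF DERIV_rescaled_k0[of 0 w x], of "{0..?b}"]
    unfolding has_field_derivative_def
    by (rule has_derivative_transform[OF x hg, rotated])
  have "continuous_on UNIV (profile_deriv q)"
    using isCont_profile_deriv[OF q] continuous_at_imp_continuous_on by blast
  then have c1: "continuous_on {0..?b} ?h1"
    using w by (intro continuous_intros continuous_on_compose2[of UNIV "profile_deriv q" _ "\<lambda>x. (x - 0) / w"]) auto
  \<comment> \<open>At the right end the slope vanishes by the first integral, because the height is
    0 there.\<close>
  have e1: "?h1 0 = 0" "?h1 ?b = 0"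
    using w k.k'_0 k.first_integral[of "P0 q"] k.P by (auto simp: k.k_P speed_sq_0[OF q])
  have steady: "steady_state_on m n B 0 ?b h"
    unfolding steady_state_on_def
  proof (intro exI ballI conjI)
    \<comment> \<open>The second derivative is written through h itself, so that differentiating it
      gives h''' = -B h^(q-1) h'. Since n + q - 1 = m, the flux is then identically zero.\<close>
    let ?h2 = "\<lambda>x. B * (qlog q l - qlog q (?g x))"
    let ?h3 = "\<lambda>x. - (B * (?g x powr (q - 1) * ?h1 x))"
    fix x assume x: "x \<in> {0<..<?b}"
    show "(h has_real_derivative ?h1 x) (at x)"
      by (rule has_field_derivative_transform_within_open[OF DERIV_rescaled_k0 _ x]) (auto simp: hg)
    show "(?h1 has_real_derivative ?h2 x) (at x)"
    proof -
      have "((\<lambda>x. (x - 0) / w) has_real_derivative 1 / w) (at x)"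
        using w by (auto intro!: derivative_eq_intros)
      from DERIV_cmult[OF DERIV_chain2[OF k.der'[OF inside[OF x]] this], of "l / w"]
      have "(?h1 has_real_derivative l / w * (- qlog q (k0 q ((x - 0) / w)) * (1 / w))) (at x)" .
      moreover have "l / w * (- qlog q (k0 q ((x - 0) / w)) * (1 / w)) = ?h2 x"
      proof -
        have "qlog q (?g x) = l powr q * qlog q (k0 q ((x - 0) / w)) + qlog q l"
          using qlog_mult[OF l k.pos[OF inside[OF x]]] .
        moreover have "l / w * (1 / w) = B * l powr q"
        proof -
          have "l / w * (1 / w) = w\<^sup>2 * B * l powr q / w\<^sup>2"
            unfolding w_def width_scale_sq[OF B l] by (simp add: power2_eq_square)
          then show ?thesis using w by simp
        qed
        moreover have "l / w * (- qlog q (k0 q ((x - 0) / w)) * (1 / w))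
            = - (l / w * (1 / w)) * qlog q (k0 q ((x - 0) / w))"
          by simp
        ultimately show ?thesis by (simp only:) (simp add: algebra_simps)
      qed
      ultimately show ?thesis by simp
    qed
    show "(?h2 has_real_derivative ?h3 x) (at x)"
      using DERIV_cmult[OF DERIV_diff[OF DERIV_const DERIV_qlog[OF DERIV_rescaled_k0 gpos[OF x]]], of B "qlog q l" q]
      by simp
    have "0 = h y powr n * ?h3 y + B * h y powr m * ?h1 y" if y: "y \<in> {0<..<?b}" for y
    proof -
      have "?g y powr n * ?g y powr (q - 1) = ?g y powr m"
        by (simp only: powr_add[symmetric] q_eq) simp
      moreover have "h y = ?g y" using hg y by auto
      ultimately show ?thesis
        by (simp only: mult_minus_right) (simp add: mult_ac)
    qed
    then show "((\<lambda>y. h y powr n * ?h3 y + B * h y powr m * ?h1 y) has_real_derivative 0) (at x)"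
      by (rule has_field_derivative_transform_within_open[OF DERIV_const open_greaterThanLessThan x])
  qed
  have "droplet_steady_state m n B 0 ?b h"
    unfolding droplet_steady_state_def
  proof (intro conjI exI[of _ ?h1] ballI allI impI)
    show "h x > 0" if "x \<in> {0<..<?b}" for x using gpos[OF that] that by (simp add: h_def)
  qed (use b dh c1 e1 steady in \<open>auto simp: h_def\<close>)
  moreover have "zero_contact_angle 0 ?b h"
    unfolding zero_contact_angle_def using dh[of 0] dh[of ?b] b unfolding e1 by simp
  moreover have "integral {0..?b} h = l * w * A0 q"
    unfolding w_def by (rule area_eq) (use hg in \<open>auto simp: w_def\<close>)
  ultimately show ?thesis by blast
qed

text \<open>On the droplet the scale relation gives \<open>(l / w)^2 = B * l powr q * l\<close>, so
  the gradient term and the \<open>k'^2\<close> part of the potential are equal and add up. Off the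
  droplet the density is the constant -\<beta>. At the endpoints of the pieces \<open>deriv\<close>
  is not computed; finitely many points do not affect the integral.\<close>

lemma energy_droplet:
  fixes a b X :: real and h H :: "real \<Rightarrow> real"
  defines "w \<equiv> width_scale q B l"
  assumes len: "b - a = w * P0 q" "b - a \<le> X" and X: "X > 0"
    and h: "\<And>x. x \<in> {a..b} \<Longrightarrow> h x = l * k0 q ((x - a) / w)"
    and out: "\<And>x. x \<notin> {a<..<b} \<Longrightarrow> h x = 0"
    and H: "\<And>y. y \<ge> 0 \<Longrightarrow> H y = - (B / 2) * speed_sq q y + \<alpha> * y + \<beta>"
  shows "energy H X (periodize X a h)
    = l * w * A0 q * (2 * B * l powr q / (q + 3) - B * qlog q l - \<alpha>) - \<beta> * X"
proof -
  have w: "w > 0" unfolding w_def by (intro width_scale_pos B l)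
  have ab: "a < b" using len(1) w k.P by (smt (verit) mult_pos_pos)
  let ?u = "periodize X a h"
  let ?f = "\<lambda>x. (deriv ?u x)\<^sup>2 / 2 - H (?u x)"
  have per: "?u (x + X) = ?u x" for x
  proof -
    have "(x + X - a) / X = (x - a) / X + 1" using X by (simp add: field_simps)
    then show ?thesis by (simp add: periodize_def frac_1_eq)
  qed
  then have "(\<lambda>x. ?u (x + X)) = ?u" by auto
  then have per': "deriv ?u (x + X) = deriv ?u x" for x
    using DERIV_shift[of ?u _ x X] by (simp add: deriv_def)
  have u: "?u x = h x" if "x \<in> {a..<a + X}" for x
  proof -
    have "frac ((x - a) / X) = (x - a) / X" using that X by (subst frac_eq) auto
    then show ?thesis using X by (simp add: periodize_def)
  qed
  let ?\<phi> = "\<lambda>t. B * l powr q * l * (profile_deriv q t)\<^sup>2 - (B * qlog q l + \<alpha>) * l * k0 q t - \<beta>"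
  have "(?\<phi> has_integral B * l powr q * l * (2 / (q + 3) * A0 q) - (B * qlog q l + \<alpha>) * l * A0 q - P0 q * \<beta>) {0..P0 q}"
    using has_integral_const_real[of \<beta> 0 "P0 q"] k.P
    by (intro has_integral_diff has_integral_mult_right has_integral_k0_deriv_sq[OF q] has_integral_k0[OF q]) simp
  from has_integral_rescale[OF this w, of a]
  have "((\<lambda>x. ?\<phi> ((x - a) / w)) has_integral
      w * (B * l powr q * l * (2 / (q + 3) * A0 q) - (B * qlog q l + \<alpha>) * l * A0 q - P0 q * \<beta>)) {a..b}"
    using len(1) by (simp add: algebra_simps)
  then have left: "(?f has_integral
      w * (B * l powr q * l * (2 / (q + 3) * A0 q) - (B * qlog q l + \<alpha>) * l * A0 q - P0 q * \<beta>)) {a..b}"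
  proof (rule has_integral_spike_finite[rotated 2])
    show "finite {a, b}" by simp
    fix x assume "x \<in> {a..b} - {a, b}"
    then have x: "x \<in> {a<..<b}" by auto
    let ?t = "(x - a) / w"
    have t: "?t \<in> {0<..<P0 q}" using x len(1) w by (auto simp: field_simps)
    have ug: "?u y = l * k0 q ((y - a) / w)" if "y \<in> {a<..<b}" for y
      using that len(2) u[of y] h[of y] by auto
    have "(?u has_real_derivative l / w * profile_deriv q ?t) (at x)"
      by (rule has_field_derivative_transform_within_open[OF DERIV_rescaled_k0 _ x]) (auto simp: ug)
    then have d: "deriv ?u x = l / w * profile_deriv q ?t" by (rule DERIV_imp_deriv)
    have "w\<^sup>2 * (B * l powr q) = l" using width_scale_sq[OF B l, of q] by (simp add: w_def mult_ac)
    then have "l / w * (1 / w) = B * l powr q"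
      using w by (simp add: field_simps power2_eq_square)
    moreover have "(l / w)\<^sup>2 = l / w * (1 / w) * l"
      by (simp add: power2_eq_square)
    ultimately have lw: "(l / w)\<^sup>2 = B * l powr q * l"
      by simp
    have k0: "k0 q ?t \<ge> 0" using k.nonneg[of ?t] t by simp
    have V: "speed_sq q (k0 q ?t) = (profile_deriv q ?t)\<^sup>2" using k.first_integral[of ?t] t by simp
    have "l * k0 q ?t \<ge> 0" using k0 l by simp
    from H[OF this] have "H (l * k0 q ?t) =
        - (B / 2) * (l powr q * l * (profile_deriv q ?t)\<^sup>2 - 2 * l * k0 q ?t * qlog q l) + \<alpha> * (l * k0 q ?t) + \<beta>"
      unfolding speed_sq_mult[OF q l k0] V .
    then show "?f x = ?\<phi> ?t"
      unfolding d ug[OF x] power_mult_distrib lw by (simp add: algebra_simps)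
  qed
  have right: "(?f has_integral - \<beta> * (a + X - b)) {b..a + X}"
  proof -
    have "((\<lambda>_. - \<beta>) has_integral - \<beta> * (a + X - b)) {b..a + X}"
      using has_integral_const_real[of "- \<beta>" b "a + X"] len(2) by (simp add: mult.commute)
    then show ?thesis
    proof (rule has_integral_spike_finite[rotated 2])
      show "finite {b, a + X}" by simp
      fix x assume "x \<in> {b..a + X} - {b, a + X}"
      then have x: "x \<in> {b<..<a + X}" by auto
      have u0: "?u y = 0" if "y \<in> {b<..<a + X}" for y
        using that ab u[of y] out[of y] by auto
      have "(?u has_real_derivative 0) (at x)"
        by (rule has_field_derivative_transform_within_open[OF DERIV_const _ x]) (auto simp: u0)
      then have "deriv ?u x = 0" by (rule DERIV_imp_deriv)
      then show "?f x = - \<beta>" using u0[OF x] H[of 0] by (simp add: speed_sq_0[OF q])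
    qed
  qed
  have "(?f has_integral (w * (B * l powr q * l * (2 / (q + 3) * A0 q) - (B * qlog q l + \<alpha>) * l * A0 q - P0 q * \<beta>))
      + - \<beta> * (a + X - b)) {a..a + X}"
    using ab len(2) by (intro has_integral_combine[OF _ _ left right]) auto
  then have "(?f has_integral (w * (B * l powr q * l * (2 / (q + 3) * A0 q) - (B * qlog q l + \<alpha>) * l * A0 q - P0 q * \<beta>))
      + - \<beta> * (a + X - b)) {0..X}"
    using X by (intro has_integral_periodic) (auto simp: per per')
  then have "energy H X ?u = (w * (B * l powr q * l * (2 / (q + 3) * A0 q) - (B * qlog q l + \<alpha>) * l * A0 q - P0 q * \<beta>))
      + - \<beta> * (a + X - b)"
    unfolding energy_def by (rule integral_unique)
  also have "a + X - b = X - w * P0 q" using len(1) by simp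
  finally show ?thesis by (simp add: algebra_simps)
qed

end

section \<open>The thresholds\<close>

text \<open>The Gaussian integral is recast as the limit of an antiderivative, which provides the
  continuous extension to height 0 required by the quadrature of the area.\<close>

lemma gaussian_primitive:
  obtains G :: "real \<Rightarrow> real"
  where "\<And>x. (G has_real_derivative exp (- x\<^sup>2)) (at x)" "G 0 = 0" "(G \<longlongrightarrow> sqrt pi / 2) at_top"
proof -
  let ?g = "\<lambda>x::real. exp (- x\<^sup>2)"
  have "\<exists>F. \<forall>x::real. -\<infinity> < ereal x \<longrightarrow> ereal x < \<infinity> \<longrightarrow> (F has_vector_derivative ?g x) (at x)"
    by (rule einterval_antiderivative) (auto intro!: continuous_intros)
  then obtain F where F: "\<And>x. (F has_vector_derivative ?g x) (at x)" by auto
  have "((\<lambda>y. \<integral>x. indicator {..y} x *\<^sub>R (indicator {0..} x *\<^sub>R ?g x) \<partial>lborel) \<longlongrightarrow>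
      (\<integral>x. indicator {0..} x *\<^sub>R ?g x \<partial>lborel)) at_top"
    by (rule tendsto_integral_at_top) (use gaussian_moment_0 in \<open>auto simp: has_bochner_integral_iff\<close>)
  then have lim: "((\<lambda>y. \<integral>x. indicator {..y} x *\<^sub>R (indicator {0..} x *\<^sub>R ?g x) \<partial>lborel) \<longlongrightarrow> sqrt pi / 2) at_top"
    using gaussian_moment_0 by (simp only: has_bochner_integral_integral_eq)
  have "(\<integral>x. indicator {..y} x *\<^sub>R (indicator {0..} x *\<^sub>R ?g x) \<partial>lborel) = F y - F 0" if "y \<ge> 0" for y
  proof -
    have "(\<integral>x. indicator {..y} x *\<^sub>R (indicator {0..} x *\<^sub>R ?g x) \<partial>lborel) = (LINT x:{0..y}|lborel. ?g x)"
      unfolding set_lebesgue_integral_def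
      by (rule Bochner_Integration.integral_cong) (auto simp: indicator_def)
    also have "\<dots> = integral {0..y} ?g"
      by (intro set_borel_integral_eq_integral borel_integrable_atLeastAtMost' continuous_intros)
    also have "\<dots> = F y - F 0"
      using F that
      by (intro integral_unique fundamental_theorem_of_calculus) (auto intro: has_vector_derivative_at_within)
    finally show ?thesis .
  qed
  then have "\<forall>\<^sub>F y in at_top. (\<integral>x. indicator {..y} x *\<^sub>R (indicator {0..} x *\<^sub>R ?g x) \<partial>lborel) = F y - F 0"
    using eventually_ge_at_top[of 0] by (rule eventually_mono[rotated]) auto
  from Lim_transform_eventually[OF lim this] have "((\<lambda>y. F y - F 0) \<longlongrightarrow> sqrt pi / 2) at_top" .
  moreover have "((\<lambda>y. F y - F 0) has_real_derivative ?g x) (at x)" for x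
    using F[of x] by (auto simp: has_real_derivative_iff_has_vector_derivative[symmetric] intro!: derivative_eq_intros)
  ultimately show ?thesis using that[of "\<lambda>y. F y - F 0"] by simp
qed

text \<open>At q = 0 the area is twice the integral of \<open>y / sqrt (2 * y * (1 - ln y))\<close>
  over the heights from 0 to e. The substitution z^2 = 3/2 (1 - ln y) turns the integrand into c
  exp(-z^2), with z running from infinity at height 0 to 0 at the peak; the constant is c = (2 /
  sqrt 3) e^(3/2).\<close>

lemma A0_0_sq: "(A0 0)\<^sup>2 = 4 * exp 1 ^ 3 * pi / 3"
proof -
  interpret k: zero_angle_arc 0 "P0 0" "k0 0" "profile_deriv 0"
    by (rule zero_angle_arc_k0) simp
  obtain G :: "real \<Rightarrow> real" where G: "\<And>x. (G has_real_derivative exp (- x\<^sup>2)) (at x)"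
      "G 0 = 0" "(G \<longlongrightarrow> sqrt pi / 2) at_top"
    using gaussian_primitive by blast
  define c :: real where "c = 2 / sqrt 3 * sqrt (exp 3)"
  define z where "z y = sqrt (3 / 2 * (1 - ln y))" for y :: real
  define \<Phi> where "\<Phi> y = (if y = 0 then - (c * (sqrt pi / 2)) else - (c * G (z y)))" for y
  have peak: "peak 0 = exp 1" by (simp add: peak_def)
  have GC: "isCont G x" for x using G(1) DERIV_isCont by blast
  have "continuous (at y within {0..peak 0}) \<Phi>" if y: "y \<in> {0..peak 0}" for y
  proof (cases "y = 0")
    case False
    have "isCont (\<lambda>y. - (c * G (z y))) y"
      unfolding z_def using False y by (intro continuous_intros isCont_o2[OF _ GC]) auto
    moreover have "\<forall>\<^sub>F x in nhds y. - (c * G (z x)) = \<Phi> x"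
      using t1_space_nhds[OF False] by eventually_elim (simp add: \<Phi>_def)
    ultimately have "isCont \<Phi> y" using isCont_cong by fast
    then show ?thesis by (rule continuous_at_imp_continuous_at_within)
  next
    case True
    have "filterlim z at_top (at_right 0)" unfolding z_def by real_asymp
    from filterlim_compose[OF G(3) this]
    have "((\<lambda>y. - (c * G (z y))) \<longlongrightarrow> - (c * (sqrt pi / 2))) (at_right 0)"
      by (intro tendsto_intros)
    moreover have "\<forall>\<^sub>F x in at_right 0. - (c * G (z x)) = \<Phi> x"
      using eventually_at_right_less[of 0] by eventually_elim (simp add: \<Phi>_def)
    ultimately have "(\<Phi> \<longlongrightarrow> - (c * (sqrt pi / 2))) (at_right 0)"
      by (rule Lim_transform_eventually)
    then have "(\<Phi> \<longlongrightarrow> \<Phi> 0) (at 0 within {0..peak 0})"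
      by (simp add: \<Phi>_def at_within_Icc_at_right peak)
    then show ?thesis using True by (simp add: continuous_within)
  qed
  then have cont: "continuous_on {0..peak 0} \<Phi>"
    by (simp add: continuous_on_eq_continuous_within)
  have der: "(\<Phi> has_real_derivative y / sqrt (speed_sq 0 y)) (at y)" if y: "0 < y" "y < peak 0" for y
  proof -
    have ln: "1 - ln y > 0" using y by (simp add: peak ln_less_cancel_iff[of y "exp 1", symmetric])
    let ?s = "sqrt (1 - ln y)"
    have s: "?s > 0" "?s\<^sup>2 = 1 - ln y" using ln by auto
    have zs: "z y = sqrt (3 / 2) * ?s" by (simp only: z_def real_sqrt_mult)
    have z2: "(z y)\<^sup>2 = 3 / 2 * (1 - ln y)" using ln by (simp add: z_def)
    have "((\<lambda>y. 3 / 2 * (1 - ln y)) has_real_derivative - (3 / 2) / y) (at y)"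
      using y by (auto intro!: derivative_eq_intros simp: field_simps)
    moreover have "3 / 2 * (1 - ln y) > 0" using ln by simp
    ultimately have "(z has_real_derivative inverse (z y) / 2 * (- (3 / 2) / y)) (at y)"
      unfolding z_def by (intro DERIV_chain2[OF DERIV_real_sqrt])
    from DERIV_minus[OF DERIV_cmult[OF DERIV_chain2[OF G(1) this]], of c]
    have "((\<lambda>y. - (c * G (z y))) has_real_derivative
        - (c * (exp (- (z y)\<^sup>2) * (inverse (z y) / 2 * (- (3 / 2) / y))))) (at y)" .
    moreover have "- (c * (exp (- (z y)\<^sup>2) * (inverse (z y) / 2 * (- (3 / 2) / y)))) = y / sqrt (speed_sq 0 y)"
    proof -
      have "exp (- (z y)\<^sup>2) = sqrt (y ^ 3) / sqrt (exp 3)"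
      proof (rule power2_eq_imp_eq)
        have "(exp (- (z y)\<^sup>2))\<^sup>2 = exp (2 * - (3 / 2 * (1 - ln y)))"
          by (simp only: z2 exp_double)
        also have "2 * - (3 / 2 * (1 - ln y)) = 3 * ln y - 3"
          by (simp add: field_simps)
        also have "exp (3 * ln y - 3) = y ^ 3 / exp 3"
          using y by (simp add: exp_diff exp_of_nat_mult[of 3, simplified])
        also have "\<dots> = (sqrt (y ^ 3) / sqrt (exp 3))\<^sup>2"
          using y by (simp add: power_divide)
        finally show "(exp (- (z y)\<^sup>2))\<^sup>2 = (sqrt (y ^ 3) / sqrt (exp 3))\<^sup>2" .
      qed (use y in auto)
      moreover have "sqrt (y ^ 3) = y * sqrt y"
        using y by (simp add: power3_eq_cube real_sqrt_mult)
      moreover have "speed_sq 0 y = 2 * y * ?s\<^sup>2"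
        using s by (simp add: speed_sq_def qlog_def)
      then have "sqrt (speed_sq 0 y) = sqrt 2 * sqrt y * ?s"
        using s(1) by (simp only: real_sqrt_mult real_sqrt_abs)
      moreover have "sqrt (3 / 2) = sqrt 3 / sqrt 2" by (rule real_sqrt_divide)
      \<comment> \<open>An identity between abstract positive numbers: t, u, r stand for the square
        roots of 3, 2 and y, s for \<open>sqrt (1 - ln y)\<close> and e for
        \<open>sqrt (exp 3)\<close>.\<close>
      moreover have "2 / t * e * (Y * r / e) * (inverse (t / u * s) / 2 * (3 / 2 / Y)) = Y / (u * r * s)"
        if "t * t = 3" "u * u = 2" "r * r = Y" "t > 0" "u > 0" "r > 0" "s > 0" "e > 0" "Y > 0"
        for t u r s e Y :: real
      proof -
        have "2 / t * e * (Y * r / e) * (inverse (t / u * s) / 2 * (3 / 2 / Y)) = (3 * (u * r)) / (2 * (t * t) * s)"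
          using that by (simp add: field_simps)
        also have "\<dots> = (u * r) / (2 * s)" using that(1) by simp
        also have "\<dots> = (u * r) * (u * r) / (2 * (u * r * s))" using that by simp
        also have "(u * r) * (u * r) = (u * u) * (r * r)" by (simp only: mult_ac)
        also have "\<dots> = 2 * Y" using that by simp
        finally show ?thesis by simp
      qed
      from this[of "sqrt 3" "sqrt 2" "sqrt y" y ?s "sqrt (exp 3)"] y s
      have "2 / sqrt 3 * sqrt (exp 3) * (y * sqrt y / sqrt (exp 3)) *
          (inverse (sqrt 3 / sqrt 2 * ?s) / 2 * (3 / 2 / y)) = y / (sqrt 2 * sqrt y * ?s)"
        by simp
      ultimately show ?thesis
        unfolding zs c_def by (simp only:)
    qed
    ultimately have "((\<lambda>y. - (c * G (z y))) has_real_derivative y / sqrt (speed_sq 0 y)) (at y)" by simp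
    then show ?thesis
      by (rule has_field_derivative_transform_within_open[where S = "{0<..}"]) (use y in \<open>auto simp: \<Phi>_def\<close>)
  qed
  have "(k0 0 has_integral 2 * (\<Phi> (peak 0) - \<Phi> 0)) {0..P0 0}"
    using k.has_integral_arc[OF cont, of "\<lambda>y. y"] der by simp
  then have "A0 0 = 2 * (\<Phi> (peak 0) - \<Phi> 0)"
    unfolding A0_def by (rule integral_unique)
  also have "\<dots> = c * sqrt pi"
    by (simp add: \<Phi>_def peak z_def G(2))
  finally have "(A0 0)\<^sup>2 = c\<^sup>2 * pi"
    by (simp add: power_mult_distrib)
  also have "c\<^sup>2 = 4 / 3 * exp 3"
    by (simp add: c_def power_mult_distrib power_divide)
  also have "exp 3 = exp (1::real) ^ 3"
    using exp_of_nat_mult[of 3 "1::real"] by simp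
  finally show ?thesis by simp
qed

section \<open>Area and length conditions as linear relations in the logarithm of the scale\<close>

lemma ln_width_scale:
  assumes "B > 0" "l > 0"
  shows "ln (width_scale q B l) = ((1 - q) * ln l - ln B) / 2"
  using assms by (simp add: width_scale_def ln_sqrt ln_div ln_powr)

lemma ln_E0:
  assumes "-1 < q"
  shows "E0 q > 0" "ln (E0 q) = (3 - q) * ln (P0 q) + (q - 1) * ln (A0 q)"
  using P0_pos[OF assms] A0_pos[OF assms]
  by (auto simp: E0_def ln_mult ln_powr)

context
  fixes m n B q hbar X :: real
  assumes q: "-1 < q" and B: "0 < B" and q_eq: "q = m - n + 1" and hbar: "0 < hbar" and X: "0 < X"
begin

lemma droplet_scale:
  assumes "zero_angle_droplet m n B X (hbar * X) a b h"
  obtains l where "l > 0" "b - a = width_scale q B l * P0 q" "b - a \<le> X"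
    "\<And>x. x \<in> {a..b} \<Longrightarrow> h x = l * k0 q ((x - a) / width_scale q B l)"
    "l * width_scale q B l * A0 q = hbar * X"
proof -
  have d: "droplet_steady_state m n B a b h" "zero_contact_angle a b h" "b - a \<le> X" "integral {a..b} h = hbar * X"
    using assms by (auto simp: zero_angle_droplet_def)
  obtain l where l: "l > 0" "b - a = width_scale q B l * P0 q"
    "\<And>x. x \<in> {a..b} \<Longrightarrow> h x = l * k0 q ((x - a) / width_scale q B l)"
    by (rule zero_angle_droplet_is_rescaled_k0[OF q q_eq B d(1,2)]) blast
  have "l * width_scale q B l * A0 q = hbar * X"
    using area_eq[OF q B l] d(4) by simp
  with l d(3) that show ?thesis by blast
qed

text \<open>The width is proportional to l^((1-q)/2), hence the area to l^((3-q)/2). This is the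
  origin of the coefficient 3 - q and of the special role of q = 3.\<close>

lemma ln_area_iff:
  assumes "l > 0"
  shows "l * width_scale q B l * A0 q = hbar * X \<longleftrightarrow>
    (3 - q) * ln l = ln B + 2 * (ln hbar + ln X - ln (A0 q))"
proof -
  have w: "width_scale q B l > 0" and A: "A0 q > 0"
    using width_scale_pos[OF B assms] A0_pos[OF q] by auto
  have "l * width_scale q B l * A0 q = hbar * X \<longleftrightarrow> ln (l * width_scale q B l * A0 q) = ln (hbar * X)"
    using w A assms hbar X by (intro ln_inj_iff[symmetric]) auto
  also have "\<dots> \<longleftrightarrow> ln l + ((1 - q) * ln l - ln B) / 2 + ln (A0 q) = ln hbar + ln X"
    using w A assms hbar X by (simp add: ln_mult ln_width_scale[OF B assms])
  also have "\<dots> \<longleftrightarrow> (3 - q) * ln l = ln B + 2 * (ln hbar + ln X - ln (A0 q))"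
    by (auto simp: field_simps)
  finally show ?thesis .
qed

lemma ln_length_iff:
  assumes "l > 0"
  shows "width_scale q B l * P0 q \<le> X \<longleftrightarrow> (1 - q) * ln l - ln B + 2 * ln (P0 q) \<le> 2 * ln X"
proof -
  have w: "width_scale q B l > 0" and P: "P0 q > 0"
    using width_scale_pos[OF B assms] P0_pos[OF q] by auto
  have "width_scale q B l * P0 q \<le> X \<longleftrightarrow> ln (width_scale q B l * P0 q) \<le> ln X"
    using w P X by (intro ln_le_cancel_iff[symmetric]) auto
  also have "\<dots> \<longleftrightarrow> (1 - q) * ln l - ln B + 2 * ln (P0 q) \<le> 2 * ln X"
    using w P by (simp add: ln_mult ln_width_scale[OF B assms]) (simp add: field_simps)
  finally show ?thesis .
qed

text \<open>The unknown t is \<open>ln l\<close>. The scale determines the droplet up to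
  translation, so it may be placed at 0.\<close>

lemma droplet_exists_iff:
  "(\<exists>a b h. zero_angle_droplet m n B X (hbar * X) a b h) \<longleftrightarrow>
    (\<exists>t. (3 - q) * t = ln B + 2 * (ln hbar + ln X - ln (A0 q)) \<and>
         (1 - q) * t - ln B + 2 * ln (P0 q) \<le> 2 * ln X)" (is "?L \<longleftrightarrow> ?R")
proof
  assume ?L
  then obtain a b h where "zero_angle_droplet m n B X (hbar * X) a b h" by blast
  then obtain l where l: "l > 0" "width_scale q B l * P0 q \<le> X" "l * width_scale q B l * A0 q = hbar * X"
    using droplet_scale by metis
  then show ?R
    using ln_area_iff[OF l(1)] ln_length_iff[OF l(1)] by blast
next
  assume ?R
  then obtain t where t: "(3 - q) * t = ln B + 2 * (ln hbar + ln X - ln (A0 q))"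
    "(1 - q) * t - ln B + 2 * ln (P0 q) \<le> 2 * ln X" by blast
  define l where "l = exp t"
  have l: "l > 0" by (simp add: l_def)
  have *: "l * width_scale q B l * A0 q = hbar * X" "width_scale q B l * P0 q \<le> X"
    using ln_area_iff[OF l] ln_length_iff[OF l] t by (auto simp: l_def)
  obtain h where "droplet_steady_state m n B 0 (width_scale q B l * P0 q) h"
    "zero_contact_angle 0 (width_scale q B l * P0 q) h"
    "integral {0..width_scale q B l * P0 q} h = l * width_scale q B l * A0 q"
    using droplet_exists[OF q B l q_eq] by blast
  then have "zero_angle_droplet m n B X (hbar * X) 0 (width_scale q B l * P0 q) h"
    using * by (simp add: zero_angle_droplet_def)
  then show ?L by blast
qed

lemma load_pos: "B * hbar powr (q - 1) * X\<^sup>2 > 0"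
  using B hbar X by simp

lemma ln_load: "ln (B * hbar powr (q - 1) * X\<^sup>2) = ln B + (q - 1) * ln hbar + 2 * ln X"
  using B hbar X by (simp add: ln_mult ln_powr ln_realpow)

text \<open>The factor 3 - q makes t appear as \<open>(3 - q) * t\<close>, which the area relation
  replaces by data; the remaining terms combine to \<open>E0\<close>. Dividing by 3 - q afterwards
  decides the direction of the inequality.\<close>

lemma length_excess:
  assumes "(3 - q) * t = ln B + 2 * (ln hbar + ln X - ln (A0 q))"
  shows "(3 - q) * ((1 - q) * t - ln B + 2 * ln (P0 q) - 2 * ln X) = 2 * (ln (E0 q) - ln (B * hbar powr (q - 1) * X\<^sup>2))"
proof -
  have "(3 - q) * ((1 - q) * t - ln B + 2 * ln (P0 q) - 2 * ln X)
      = (1 - q) * ((3 - q) * t) + (3 - q) * (2 * ln (P0 q) - 2 * ln X - ln B)"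
    by (simp add: algebra_simps)
  also have "\<dots> = 2 * (ln (E0 q) - ln (B * hbar powr (q - 1) * X\<^sup>2))"
    unfolding assms ln_load ln_E0(2)[OF q] by (simp add: algebra_simps)
  finally show ?thesis .
qed

lemma droplet_exists_iff_subcritical:
  assumes "q < 3"
  shows "(\<exists>a b h. zero_angle_droplet m n B X (hbar * X) a b h) \<longleftrightarrow> B * hbar powr (q - 1) * X\<^sup>2 \<ge> E0 q"
proof -
  let ?c = "ln B + 2 * (ln hbar + ln X - ln (A0 q))"
  have "(3 - q) * t = ?c \<longleftrightarrow> t = ?c / (3 - q)" for t using assms by (auto simp: field_simps)
  moreover from this have "(3 - q) * (?c / (3 - q)) = ?c" by blast
  note length_excess[OF this]
  moreover have "y \<le> 0 \<longleftrightarrow> (3 - q) * y \<le> 0" for y using assms by (simp add: mult_le_0_iff)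
  ultimately have "(\<exists>t. (3 - q) * t = ?c \<and> (1 - q) * t - ln B + 2 * ln (P0 q) \<le> 2 * ln X)
      \<longleftrightarrow> ln (E0 q) \<le> ln (B * hbar powr (q - 1) * X\<^sup>2)"
    by (metis (no_types, opaque_lifting) diff_le_0_iff_le mult_le_cancel_left_pos mult_zero_right zero_less_numeral)
  then show ?thesis
    unfolding droplet_exists_iff using ln_le_cancel_iff[OF ln_E0(1)[OF q] load_pos] by simp
qed

lemma droplet_exists_iff_supercritical:
  assumes "q > 3"
  shows "(\<exists>a b h. zero_angle_droplet m n B X (hbar * X) a b h) \<longleftrightarrow> B * hbar powr (q - 1) * X\<^sup>2 \<le> E0 q"
proof -
  let ?c = "ln B + 2 * (ln hbar + ln X - ln (A0 q))"
  have "(3 - q) * t = ?c \<longleftrightarrow> t = ?c / (3 - q)" for t using assms by (auto simp: field_simps)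
  moreover from this have "(3 - q) * (?c / (3 - q)) = ?c" by blast
  note length_excess[OF this]
  moreover have "y \<le> 0 \<longleftrightarrow> 0 \<le> (3 - q) * y" for y using assms by (simp add: zero_le_mult_iff)
  ultimately have "(\<exists>t. (3 - q) * t = ?c \<and> (1 - q) * t - ln B + 2 * ln (P0 q) \<le> 2 * ln X)
      \<longleftrightarrow> ln (B * hbar powr (q - 1) * X\<^sup>2) \<le> ln (E0 q)"
    by (metis (no_types, opaque_lifting) diff_le_0_iff_le diff_ge_0_iff_ge mult_le_cancel_left_pos mult_zero_right zero_less_numeral)
  then show ?thesis
    unfolding droplet_exists_iff using ln_le_cancel_iff[OF load_pos ln_E0(1)[OF q]] by simp
qed

lemma droplet_exists_iff_critical:
  assumes "q = 3"
  shows "(\<exists>a b h. zero_angle_droplet m n B X (hbar * X) a b h) \<longleftrightarrow> B * hbar powr (q - 1) * X\<^sup>2 = E0 q"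
proof -
  have "B * hbar powr (q - 1) * X\<^sup>2 = E0 q \<longleftrightarrow> ln (B * hbar powr (q - 1) * X\<^sup>2) = ln (E0 q)"
    using ln_inj_iff[OF load_pos ln_E0(1)[OF q]] by simp
  also have "\<dots> \<longleftrightarrow> ln B + 2 * (ln hbar + ln X - ln (A0 q)) = 0"
    unfolding ln_load ln_E0(2)[OF q] using assms by auto
  also have "\<dots> \<longleftrightarrow> (\<exists>t. (3 - q) * t = ln B + 2 * (ln hbar + ln X - ln (A0 q)) \<and>
         (1 - q) * t - ln B + 2 * ln (P0 q) \<le> 2 * ln X)"
    \<comment> \<open>At q = 3 the area relation leaves t free and becomes the whole condition. The
      witness t makes the droplet exactly as long as the circle.\<close>
    using assms by (auto intro!: exI[of _ "ln (P0 q) - ln X - ln B / 2"])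
  finally show ?thesis unfolding droplet_exists_iff by simp
qed

text \<open>The affine part of H contributes -\<alpha> hbar X - \<beta> X to both energies, since
  the areas agree, and drops out. The sign of the gap is that of the bracket.\<close>

lemma energy_gap:
  assumes H: "energy_density B q H" and drop: "zero_angle_droplet m n B X (hbar * X) a b h"
  obtains l where "l > 0" "(3 - q) * ln l = ln B + 2 * (ln hbar + ln X - ln (A0 q))"
    "energy H X (\<lambda>_. hbar) - energy H X (periodize X a h)
      = hbar * X * B * ((1 - qlog q hbar) / (q + 1) - 2 * l powr q / (q + 3) + qlog q l)"
proof -
  obtain l where l: "l > 0" "b - a = width_scale q B l * P0 q" "b - a \<le> X"
    "\<And>x. x \<in> {a..b} \<Longrightarrow> h x = l * k0 q ((x - a) / width_scale q B l)"
    "l * width_scale q B l * A0 q = hbar * X"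
    by (rule droplet_scale[OF drop]) blast
  obtain \<alpha> \<beta> where H: "\<And>y. y \<ge> 0 \<Longrightarrow> H y = - (B / 2) * speed_sq q y + \<alpha> * y + \<beta>"
    by (rule energy_density_eq[OF q H]) blast
  have out: "\<And>x. x \<notin> {a<..<b} \<Longrightarrow> h x = 0"
    using drop by (auto simp: zero_angle_droplet_def droplet_steady_state_def)
  have "energy H X (periodize X a h) = hbar * X * (2 * B * l powr q / (q + 3) - B * qlog q l - \<alpha>) - \<beta> * X"
    using energy_droplet[OF q B l(1,2,3) X l(4) out H] l(5) by simp
  moreover have "energy H X (\<lambda>_. hbar) = - X * (- (B / 2) * speed_sq q hbar + \<alpha> * hbar + \<beta>)"
    using energy_const[OF X] H[of hbar] hbar by simp
  moreover have "- (B / 2) * speed_sq q hbar = - (B * hbar * ((1 - qlog q hbar) / (q + 1)))"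
    by (simp add: speed_sq_def)
  ultimately have "energy H X (\<lambda>_. hbar) - energy H X (periodize X a h)
      = - X * (- (B * hbar * ((1 - qlog q hbar) / (q + 1))) + \<alpha> * hbar + \<beta>)
        - (hbar * X * (2 * B * l powr q / (q + 3) - B * qlog q l - \<alpha>) - \<beta> * X)"
    by (simp only:)
  also have "\<dots> = hbar * X * B * ((1 - qlog q hbar) / (q + 1) - 2 * l powr q / (q + 3) + qlog q l)"
  proof -
    have "- X * (- (B * hbar * t) + \<alpha> * hbar + \<beta>) - (hbar * X * (B * s - B * u - \<alpha>) - \<beta> * X)
        = hbar * X * B * (t - s + u)" for s t u
      by (simp add: algebra_simps)
    moreover have "2 * B * l powr q / (q + 3) = B * (2 * l powr q / (q + 3))" by simp
    ultimately show ?thesis by (simp only:)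
  qed
  finally show ?thesis
    using that l(1) ln_area_iff[OF l(1)] l(5) by blast
qed

text \<open>The terms 1/q produced by the two q-logarithms cancel, leaving a comparison of
  \<open>l powr q\<close>, times a factor with the sign of 3 - q, with \<open>hbar powr q\<close>.
  For q \<ge> 3 this alone makes the bracket negative.\<close>

lemma energy_bracket:
  assumes "l > 0" "q \<noteq> 0"
  shows "(1 - qlog q hbar) / (q + 1) - 2 * l powr q / (q + 3) + qlog q l
    = (l powr q * ((3 - q) * (q + 1) / (q + 3)) - hbar powr q) / (q * (q + 1))"
proof -
  have "(1 - (v - 1) / q) / (q + 1) - 2 * u / (q + 3) + (u - 1) / q
      = (u * ((3 - q) * (q + 1) / (q + 3)) - v) / (q * (q + 1))" for u v
  proof -
    have nz: "q + 1 \<noteq> 0" "q + 3 \<noteq> 0" using q by auto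
    have 1: "(1 - (v - 1) / q) / (q + 1) = 1 / q - v / (q * (q + 1))"
      using nz assms(2) by (simp add: divide_simps)
    have 2: "(u - 1) / q - 2 * u / (q + 3) = u * (3 - q) / (q * (q + 3)) - 1 / q"
      using nz assms(2) by (simp add: divide_simps) (simp add: algebra_simps)
    have 3: "(u * ((3 - q) * (q + 1) / (q + 3)) - v) / (q * (q + 1))
        = u * (3 - q) / (q * (q + 3)) - v / (q * (q + 1))"
      using nz assms(2) by (simp add: divide_simps)
    show ?thesis using 1 2 3 by linarith
  qed
  then show ?thesis using assms(2) by (simp add: qlog_def)
qed

lemma energy_supercritical:
  assumes "energy_density B q H" "zero_angle_droplet m n B X (hbar * X) a b h" "q \<ge> 3"
  shows "energy H X (\<lambda>_. hbar) < energy H X (periodize X a h)"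
proof -
  obtain l where l: "l > 0" "energy H X (\<lambda>_. hbar) - energy H X (periodize X a h)
      = hbar * X * B * ((1 - qlog q hbar) / (q + 1) - 2 * l powr q / (q + 3) + qlog q l)"
    using energy_gap[OF assms(1,2)] by blast
  have "(3 - q) * (q + 1) / (q + 3) \<le> 0"
    using assms(3) by (intro divide_nonpos_pos mult_nonpos_nonneg) auto
  then have "l powr q * ((3 - q) * (q + 1) / (q + 3)) \<le> 0"
    by (intro mult_nonneg_nonpos) auto
  moreover have "hbar powr q > 0" using hbar by simp
  ultimately have "l powr q * ((3 - q) * (q + 1) / (q + 3)) - hbar powr q < 0" by linarith
  then have "(l powr q * ((3 - q) * (q + 1) / (q + 3)) - hbar powr q) / (q * (q + 1)) < 0"
    using assms(3) by (intro divide_neg_pos) auto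
  then have "energy H X (\<lambda>_. hbar) - energy H X (periodize X a h) < 0"
    unfolding l(2) energy_bracket[OF l(1), OF less_imp_neq[OF order_less_le_trans[OF zero_less_numeral assms(3)], symmetric]]
    using hbar X B by (intro mult_pos_neg) auto
  then show ?thesis by simp
qed

lemma energy_subcritical:
  assumes "energy_density B q H" "zero_angle_droplet m n B X (hbar * X) a b h" "q < 3"
  shows "energy H X (\<lambda>_. hbar) > energy H X (periodize X a h) \<longleftrightarrow> B * hbar powr (q - 1) * X\<^sup>2 > L q"
proof -
  obtain l where l: "l > 0" "(3 - q) * ln l = ln B + 2 * (ln hbar + ln X - ln (A0 q))"
    "energy H X (\<lambda>_. hbar) - energy H X (periodize X a h)
      = hbar * X * B * ((1 - qlog q hbar) / (q + 1) - 2 * l powr q / (q + 3) + qlog q l)"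
    using energy_gap[OF assms(1,2)] .
  let ?br = "(1 - qlog q hbar) / (q + 1) - 2 * l powr q / (q + 3) + qlog q l"
  have "energy H X (\<lambda>_. hbar) > energy H X (periodize X a h) \<longleftrightarrow> 0 < hbar * X * B * ?br"
    using l(3) by linarith
  also have "\<dots> \<longleftrightarrow> ?br > 0"
    using hbar X B by (metis mult_pos_pos zero_less_mult_pos)
  finally have E: "energy H X (\<lambda>_. hbar) > energy H X (periodize X a h) \<longleftrightarrow> ?br > 0" .
  \<comment> \<open>The area relation eliminates B and X: only A(0) and the ratio l/hbar
    remain.\<close>
  have bif: "ln (B * hbar powr (q - 1) * X\<^sup>2) = 2 * ln (A0 q) + (3 - q) * (ln l - ln hbar)"
    unfolding ln_load right_diff_distrib l(2) by (simp add: algebra_simps)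
  have A: "A0 q > 0" using A0_pos[OF q] .
  have Lpos: "L q > 0"
    using A q assms(3) by (auto simp: L_def)
  have L_iff: "B * hbar powr (q - 1) * X\<^sup>2 > L q \<longleftrightarrow> ln (B * hbar powr (q - 1) * X\<^sup>2) > ln (L q)"
    using Lpos load_pos by simp
  show ?thesis
  proof (cases "q = 0")
    case True
    \<comment> \<open>The factor 1/e is the limit, as q tends to 0, of the power in the general
      formula for L(q); it becomes the -1 in the logarithmic condition.\<close>
    have "L q = (A0 q)\<^sup>2 / exp 1"
      using True A0_0_sq by (simp add: L_def power2_eq_square power3_eq_cube)
    then have "ln (L q) = 2 * ln (A0 q) - 1"
      using A by (simp add: ln_div ln_realpow)
    then have "B * hbar powr (q - 1) * X\<^sup>2 > L q \<longleftrightarrow> 3 * (ln l - ln hbar) > -1"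
      unfolding L_iff bif using True by auto
    moreover have "?br = 1 / 3 - ln hbar + ln l"
      using True l(1) by (simp add: qlog_def)
    ultimately show ?thesis unfolding E by auto
  next
    case False
    \<comment> \<open>The reciprocal of the base in L(q), and at the same time the coefficient in
      the energy bracket: the gap vanishes when (l/hbar)^q = 1/\<rho>.\<close>
    let ?\<rho> = "(3 - q) * (q + 1) / (q + 3)"
    have \<rho>: "?\<rho> > 0" using q assms(3) by simp
    have inv: "(3 + q) / ((3 - q) * (q + 1)) = inverse ?\<rho>"
      by (simp add: add.commute)
    have "ln ((A0 q)\<^sup>2 * inverse r powr s) = 2 * ln (A0 q) - s * ln r" if "r > 0" for r s
      using A that by (simp add: ln_mult ln_realpow ln_powr ln_inverse)
    from this[OF \<rho>, of "(3 - q) / q"]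
    have "ln (L q) = 2 * ln (A0 q) - (3 - q) / q * ln ?\<rho>"
      unfolding L_def inv using False by (simp only: if_False)
    then have "B * hbar powr (q - 1) * X\<^sup>2 > L q \<longleftrightarrow> (3 - q) * (ln l - ln hbar + ln ?\<rho> / q) > 0"
      unfolding L_iff bif distrib_left times_divide_eq_right times_divide_eq_left by linarith
    also have "\<dots> \<longleftrightarrow> (ln l - ln hbar + ln ?\<rho> / q) > 0"
      using assms(3) by (simp add: zero_less_mult_iff)
    also have "ln l - ln hbar + ln ?\<rho> / q = (ln (l powr q * ?\<rho>) - ln (hbar powr q)) / q"
    proof -
      have "ln (l powr q * ?\<rho>) = q * ln l + ln ?\<rho>"
        using l(1) \<rho> by (simp only: ln_mult_pos powr_gt_zero ln_powr) 
      moreover have "ln (hbar powr q) = q * ln hbar" using hbar by (simp add: ln_powr)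
      ultimately show ?thesis using False by (simp only:) (simp add: field_simps)
    qed
    \<comment> \<open>Monotonicity of ln preserves the sign of the numerator. As q may be negative,
      both signs have to be compared.\<close>
    also have "\<dots> > 0 \<longleftrightarrow> (l powr q * ?\<rho> - hbar powr q) / q > 0"
    proof -
      have "0 < l powr q * ?\<rho>" "0 < hbar powr q"
        using mult_pos_pos[OF _ \<rho>, of "l powr q"] l(1) hbar by simp_all
      from ln_less_cancel_iff[OF this] ln_less_cancel_iff[OF this(2,1)]
      show ?thesis by (simp only: zero_less_divide_iff diff_gt_0_iff_gt diff_less_0_iff_less)
    qed
    also have "\<dots> \<longleftrightarrow> ?br > 0"
    proof -
      have "?br = (l powr q * ?\<rho> - hbar powr q) / q / (q + 1)"
        unfolding energy_bracket[OF l(1) False] by (simp only: divide_divide_eq_left)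
      then show ?thesis using q by (simp only: zero_less_divide_iff) auto
    qed
    finally show ?thesis unfolding E ..
  qed
qed

end

theorem theorem11:
  fixes m n B q hbar X :: real and H :: "real \<Rightarrow> real"
  assumes "B > 0" and "q = m - n + 1" and "hbar > 0" and "X > 0"
    and "energy_density B q H"
  shows
    "(-1 < q \<and> q < 3 \<longrightarrow>
        ((\<exists>a b h. zero_angle_droplet m n B X (hbar * X) a b h)
           \<longleftrightarrow> B * hbar powr (q - 1) * X\<^sup>2 \<ge> E0 q) \<and>
        (\<forall>a b h. zero_angle_droplet m n B X (hbar * X) a b h \<longrightarrow>
           (energy H X (\<lambda>_. hbar) > energy H X (periodize X a h)
              \<longleftrightarrow> B * hbar powr (q - 1) * X\<^sup>2 > L q))) \<and>
     (q = 3 \<longrightarrow>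
        ((\<exists>a b h. zero_angle_droplet m n B X (hbar * X) a b h)
           \<longleftrightarrow> B * hbar\<^sup>2 * X\<^sup>2 = E0 q)) \<and>
     (q > 3 \<longrightarrow>
        ((\<exists>a b h. zero_angle_droplet m n B X (hbar * X) a b h)
           \<longleftrightarrow> B * hbar powr (q - 1) * X\<^sup>2 \<le> E0 q)) \<and>
     (q \<ge> 3 \<longrightarrow>
        (\<forall>a b h. zero_angle_droplet m n B X (hbar * X) a b h \<longrightarrow>
           energy H X (\<lambda>_. hbar) < energy H X (periodize X a h)))"
proof (intro conjI impI allI)
  show "(\<exists>a b h. zero_angle_droplet m n B X (hbar * X) a b h)
      \<longleftrightarrow> B * hbar powr (q - 1) * X\<^sup>2 \<ge> E0 q" if "-1 < q \<and> q < 3"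
    using droplet_exists_iff_subcritical[OF _ assms(1,2,3,4)] that by blast
  show "energy H X (\<lambda>_. hbar) > energy H X (periodize X a h)
      \<longleftrightarrow> B * hbar powr (q - 1) * X\<^sup>2 > L q"
    if "-1 < q \<and> q < 3" "zero_angle_droplet m n B X (hbar * X) a b h" for a b h
    using energy_subcritical[OF _ assms(1,2,3,4,5) that(2)] that(1) by blast
  show "(\<exists>a b h. zero_angle_droplet m n B X (hbar * X) a b h)
      \<longleftrightarrow> B * hbar\<^sup>2 * X\<^sup>2 = E0 q" if "q = 3"
    using droplet_exists_iff_critical[OF _ assms(1,2,3,4) that] that assms(3) by simp
  show "(\<exists>a b h. zero_angle_droplet m n B X (hbar * X) a b h)
      \<longleftrightarrow> B * hbar powr (q - 1) * X\<^sup>2 \<le> E0 q" if "q > 3"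
    using droplet_exists_iff_supercritical[OF _ assms(1,2,3,4) that] that by simp
  show "energy H X (\<lambda>_. hbar) < energy H X (periodize X a h)"
    if "q \<ge> 3" "zero_angle_droplet m n B X (hbar * X) a b h" for a b h
    using energy_supercritical[OF _ assms(1,2,3,4,5) that(2,1)] that(1) by simp
qed

end
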